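(* Let $P$ be a finite poset. There exists $n_{0}=n_{0}(P)$ such that for every $n\geq n_{0}$ there exists a family $\mathcal{P}$ of pairwise disjoint copies of $P$ in $2^{[n]}-\{\emptyset,[n]\}$ such that the number of elements of $2^{[n]}-\{\emptyset,[n]\}$ not covered by any member of $\mathcal{P}$ is at most $|P|-1$.
   Context: $2^{[n]}$ denotes the power set of $[n]=\{1,\dots,n\}$ ordered by inclusion, and $2^{[n]}-\{\emptyset,[n]\}$ is the induced subposet obtained by removing its minimum and maximum. A subset $Q'$ of a poset $Q$ is a copy of $P$ if the subposet of $Q$ induced on $Q'$ is isomorphic to $P$. *)

theory Defs
  imports Main
begin

definition poset_isomorphic :: "'a set \<Rightarrow> 'a rel \<Rightarrow> 'b set \<Rightarrow> 'b rel \<Rightarrow> bool" where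
  "poset_isomorphic A r B s \<longleftrightarrow>
    (\<exists>f. bij_betw f A B \<and> (\<forall>x\<in>A. \<forall>y\<in>A. (x, y) \<in> r \<longleftrightarrow> (f x, f y) \<in> s))"

(* Posets are pairs of a carrier and a reflexive order relation on it;
   is_copy A r Q s Q' says that the subset Q' of (Q, s) is a copy of (A, r). *)
definition is_copy :: "'a set \<Rightarrow> 'a rel \<Rightarrow> 'b set \<Rightarrow> 'b rel \<Rightarrow> 'b set \<Rightarrow> bool" where
  "is_copy A r Q s Q' \<longleftrightarrow> Q' \<subseteq> Q \<and> poset_isomorphic A r Q' (Restr s Q')"

definition middle_cube :: "nat \<Rightarrow> nat set set" where
  "middle_cube n = Pow {1..n} - {{}, {1..n}}"

definition inclusion_on :: "'a set set \<Rightarrow> 'a set rel" where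
  "inclusion_on Q = relation_of (\<subseteq>) Q"

(* On the field of a reflexive relation the isomorphism notion agrees with the library's iso. *)
lemma poset_isomorphic_iff_iso:
  assumes "partial_order_on A r" "partial_order_on B s"
  shows "poset_isomorphic A r B s \<longleftrightarrow> (\<exists>f. iso r s f)"
proof -
  have "Field r = A" "Field s = B"
    using partial_order_onD(1,4)[OF assms(1)] partial_order_onD(1,4)[OF assms(2)]
    by (auto simp: Field_def refl_on_def)
  then show ?thesis
    unfolding poset_isomorphic_def iso_iff2 by simp
qed

lemma partial_order_on_inclusion_on: "partial_order_on Q (inclusion_on Q)"
  unfolding inclusion_on_def relation_of_def order_on_defs refl_on_def trans_def antisym_def
  by auto

end

theory Submission
  imports Defs "HOL-Library.Ramsey" "HOL-Library.Product_Order" "HOL-Library.Disjoint_Sets"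
    "HOL-Library.FuncSet"
begin

text \<open>
  Call a set of points tileable if it is a disjoint union of copies of \<open>P\<close>.

  The core is that \<open>Q \<times> \<Sigma>\<^sup>N\<close> is tileable, where \<open>Q\<close> is a punctured cube times a cube with \<open>|P|\<close>
  dividing \<open>|Q|\<close>, \<open>\<Sigma>\<close> is a power set and \<open>N\<close> is large. By Ramsey's theorem \<open>\<Sigma>\<close> contains disjoint copies
  of \<open>P \<times> P\<close> such that each letter outside of them lies entirely below or entirely above one of them.
  A word with a letter in such a block is tiled by the row of the block at its first such
  letter. A word \<open>w\<close> without one is left over, but the points \<open>(d, w)\<close>, for \<open>d\<close> in a group of \<open>|P|\<close>
  elements of \<open>Q\<close>, can be absorbed: put the block of some letter of \<open>w\<close> at its position and replace all
  rows but one of the block by columns, each completed by one of the points \<open>(d, w)\<close>. Choosing the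
  position by a checksum makes \<open>w\<close> and the group recoverable, so that no row is used twice.

  Hence the sets meeting but not containing a fixed \<open>m\<close>-set are tileable in every large cube. Replacing
  a point by \<open>m\<close> points repeatedly, the \<open>m\<close>-set may be replaced by a set \<open>B\<close> missing only boundedly
  many points, so boundedly many sets remain: those that avoid or contain \<open>B\<close>. As \<open>B\<close> is huge,
  there is room to exchange each of them for an element of a tile of our choice, such that
  the elements given up form copies of \<open>P\<close>; only fewer than \<open>|P|\<close> sets are left.
\<close>

section \<open>Tileable sets\<close>

locale finite_poset =
  fixes A :: "'a set" and r :: "'a rel"
  assumes fin: "finite A" and ne: "A \<noteq> {}" and po: "partial_order_on A r"
begin

lemma r_refl: "x \<in> A \<Longrightarrow> (x, x) \<in> r"
  using po by (auto simp: order_on_defs refl_on_def)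

lemma r_trans: "(x, y) \<in> r \<Longrightarrow> (y, z) \<in> r \<Longrightarrow> (x, z) \<in> r"
  using po by (auto simp: order_on_defs dest: transD)

lemma r_antisym: "(x, y) \<in> r \<Longrightarrow> (y, x) \<in> r \<Longrightarrow> x = y"
  using po by (auto simp: order_on_defs dest: antisymD)

lemma card_pos: "card A > 0"
  using fin ne by (simp add: card_gt_0_iff)

text \<open>Reflecting the order forces injectivity on \<open>A\<close>, by antisymmetry of
  \<open>r\<close>, so the image of \<open>A\<close> is a copy of the poset.\<close>

definition emb :: "('a \<Rightarrow> 'b::order) \<Rightarrow> bool" where
  "emb f \<longleftrightarrow> (\<forall>x\<in>A. \<forall>y\<in>A. (x, y) \<in> r \<longleftrightarrow> f x \<le> f y)"

text \<open>The ambient order is that of the type: inclusion for sets, componentwise for pairs,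
  pointwise for functions. Hence tilings move along every order embedding.\<close>

definition tile :: "'b::order set \<Rightarrow> bool" where
  "tile X \<longleftrightarrow> (\<exists>\<P>. (\<forall>K\<in>\<P>. \<exists>f. emb f \<and> K = f ` A) \<and> pairwise disjnt \<P> \<and> \<Union>\<P> = X)"

lemma embI: "(\<And>x y. x \<in> A \<Longrightarrow> y \<in> A \<Longrightarrow> (x, y) \<in> r \<longleftrightarrow> f x \<le> f y) \<Longrightarrow> emb f"
  by (simp add: emb_def)

lemma embD: "emb f \<Longrightarrow> x \<in> A \<Longrightarrow> y \<in> A \<Longrightarrow> (x, y) \<in> r \<longleftrightarrow> f x \<le> f y"
  by (simp add: emb_def)

lemma emb_inj_on: "emb f \<Longrightarrow> inj_on f A"
  unfolding emb_def inj_on_def by (metis order_refl r_antisym)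

lemma tile_emb: "emb f \<Longrightarrow> tile (f ` A)"
  unfolding tile_def by (rule exI[of _ "{f ` A}"]) auto

lemma tile_empty: "tile {}"
  unfolding tile_def by (rule exI[of _ "{}"]) auto

lemma tile_UN:
  assumes "\<And>i. i \<in> I \<Longrightarrow> tile (K i)" and "disjoint_family_on K I"
  shows "tile (\<Union>i\<in>I. K i)"
proof -
  have "\<forall>i\<in>I. \<exists>\<P>. (\<forall>K\<in>\<P>. \<exists>f. emb f \<and> K = f ` A) \<and> pairwise disjnt \<P> \<and> \<Union>\<P> = K i"
    using assms(1) unfolding tile_def by blast
  then obtain \<P> where P: "\<And>i. i \<in> I \<Longrightarrow> (\<forall>K\<in>\<P> i. \<exists>f. emb f \<and> K = f ` A)"
    "\<And>i. i \<in> I \<Longrightarrow> pairwise disjnt (\<P> i)" "\<And>i. i \<in> I \<Longrightarrow> \<Union>(\<P> i) = K i"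
    by metis
  have "pairwise disjnt (\<Union>i\<in>I. \<P> i)"
  proof (rule pairwiseI)
    fix X Y assume X: "X \<in> (\<Union>i\<in>I. \<P> i)" and Y: "Y \<in> (\<Union>i\<in>I. \<P> i)" and "X \<noteq> Y"
    obtain i j where ij: "i \<in> I" "X \<in> \<P> i" "j \<in> I" "Y \<in> \<P> j" using X Y by blast
    show "disjnt X Y"
    proof (cases "i = j")
      case True
      then show ?thesis using P(2) ij \<open>X \<noteq> Y\<close> by (metis pairwiseD)
    next
      case False
      then have "K i \<inter> K j = {}" using assms(2) ij by (auto simp: disjoint_family_on_def)
      then show ?thesis using P(3) ij unfolding disjnt_def by blast
    qed
  qed
  moreover have "\<Union>(\<Union>i\<in>I. \<P> i) = (\<Union>i\<in>I. K i)"
    using P(3) by blast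
  ultimately show ?thesis
    unfolding tile_def using P(1) by (intro exI[of _ "\<Union>i\<in>I. \<P> i"]) blast
qed

lemma tile_Un:
  assumes "tile X" "tile Y" "X \<inter> Y = {}"
  shows "tile (X \<union> Y)"
proof -
  have "tile (\<Union>b\<in>(UNIV::bool set). if b then X else Y)"
    using assms by (intro tile_UN) (auto simp: disjoint_family_on_def)
  then show ?thesis by (simp add: UNIV_bool Un_commute)
qed

text \<open>The sets \<open>c x\<close> act as equivalence classes: two that share a point coincide,
  so they partition \<open>X\<close> into copies.\<close>

lemma tile_classes:
  assumes "\<And>x. x \<in> X \<Longrightarrow> \<exists>f. emb f \<and> c x = f ` A" and "\<And>x. x \<in> X \<Longrightarrow> x \<in> c x"
    and "\<And>x. x \<in> X \<Longrightarrow> c x \<subseteq> X" and "\<And>x y. x \<in> X \<Longrightarrow> y \<in> c x \<Longrightarrow> c y = c x"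
  shows "tile X"
proof -
  have "pairwise disjnt (c ` X)"
    unfolding pairwise_def disjnt_def using assms(4) by blast
  moreover have "\<Union>(c ` X) = X"
    using assms(2,3) by blast
  ultimately show ?thesis
    unfolding tile_def using assms(1) by (intro exI[of _ "c ` X"]) blast
qed

lemma tile_image:
  assumes "tile X" and g: "\<And>x y. x \<in> X \<Longrightarrow> y \<in> X \<Longrightarrow> x \<le> y \<longleftrightarrow> g x \<le> g y"
  shows "tile (g ` X)"
proof -
  obtain \<P> where P: "\<forall>K\<in>\<P>. \<exists>f. emb f \<and> K = f ` A" "pairwise disjnt \<P>" "\<Union>\<P> = X"
    using assms(1) unfolding tile_def by blast
  have inj: "inj_on g X"
    by (rule inj_onI) (metis g order_refl antisym)
  have disj: "pairwise disjnt ((`) g ` \<P>)"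
  proof (rule pairwiseI)
    fix S T assume "S \<in> (`) g ` \<P>" "T \<in> (`) g ` \<P>" "S \<noteq> T"
    then obtain S' T' where "S = g ` S'" "T = g ` T'" "S' \<in> \<P>" "T' \<in> \<P>" "S' \<noteq> T'" by blast
    moreover from this have "S' \<inter> T' = {}" using P(2) by (auto simp: pairwise_def disjnt_def)
    ultimately show "disjnt S T"
      using inj P(3) unfolding disjnt_def
      by (metis Union_upper image_empty inj_on_image_Int)
  qed
  have copies: "\<exists>f. emb f \<and> g ` K = f ` A" if "K \<in> \<P>" for K
  proof -
    obtain f where f: "emb f" "K = f ` A" using P(1) \<open>K \<in> \<P>\<close> by blast
    have "f x \<in> X" if "x \<in> A" for x using f P(3) \<open>K \<in> \<P>\<close> that by blast
    then have "emb (g \<circ> f)"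
      using f(1) g unfolding emb_def by simp
    then show ?thesis using f(2) by (intro exI[of _ "g \<circ> f"]) (simp add: image_comp)
  qed
  have un: "\<Union>((`) g ` \<P>) = g ` X"
    using P(3) by blast
  show ?thesis
    unfolding tile_def
  proof (rule exI[of _ "(`) g ` \<P>"], intro conjI ballI)
    fix S assume "S \<in> (`) g ` \<P>"
    then show "\<exists>f. emb f \<and> S = f ` A" using copies by blast
  qed (fact disj un)+
qed

text \<open>A tiling survives the removal of one of its copies. This sets aside the tile on which
  the final exchange takes place.\<close>

lemma tile_obtain:
  assumes "tile X" "X \<noteq> {}"
  obtains f where "emb f" "f ` A \<subseteq> X" "tile (X - f ` A)"
proof -
  obtain \<P> where P: "\<forall>K\<in>\<P>. \<exists>f. emb f \<and> K = f ` A" "pairwise disjnt \<P>" "\<Union>\<P> = X"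
    using assms(1) unfolding tile_def by blast
  then obtain K where K: "K \<in> \<P>" using assms(2) by blast
  then obtain f where f: "emb f" "K = f ` A" using P(1) by blast
  have "pairwise disjnt (\<P> - {K})" using P(2) by (rule pairwise_subset) auto
  moreover have "\<Union>(\<P> - {K}) = X - K"
    using P(2,3) K unfolding pairwise_def disjnt_def by blast
  ultimately have "tile (X - K)"
    unfolding tile_def using P(1) by (intro exI[of _ "\<P> - {K}"]) blast
  then show thesis using that f K P(3) by blast
qed

text \<open>A maximal element is taken above a minimal one. Their comparability keeps the final
  exchange order preserving where a minimal role meets a maximal one.\<close>

lemma ex_min_below_max:
  obtains x0 x1 where "x0 \<in> A" "x1 \<in> A" "(x0, x1) \<in> r"
    "\<And>v. v \<in> A \<Longrightarrow> (v, x0) \<in> r \<Longrightarrow> v = x0" "\<And>v. v \<in> A \<Longrightarrow> (x1, v) \<in> r \<Longrightarrow> v = x1"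
proof -
  \<comment> \<open>Stated for an arbitrary transitive antisymmetric \<open>s\<close>, so that the
    converse of \<open>r\<close> yields minimal elements and \<open>r\<close> maximal ones.\<close>
  have ex: "\<exists>x\<in>S. \<forall>y\<in>S. (x, y) \<in> s \<longrightarrow> y = x"
    if S: "S \<subseteq> A" "S \<noteq> {}" and s: "\<And>x y z. (x, y) \<in> s \<Longrightarrow> (y, z) \<in> s \<Longrightarrow> (x, z) \<in> s"
      "\<And>x y. (x, y) \<in> s \<Longrightarrow> (y, x) \<in> s \<Longrightarrow> x = y" for S and s :: "'a rel"
    using finite_subset[OF S(1) fin] S(2)
  proof (induction S rule: finite_ne_induct)
    case (insert a F)
    then obtain x where x: "x \<in> F" "\<forall>y\<in>F. (x, y) \<in> s \<longrightarrow> y = x" by blast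
    show ?case
    proof (cases "(x, a) \<in> s")
      case True
      then have "\<forall>y\<in>insert a F. (a, y) \<in> s \<longrightarrow> y = a"
        using x s by (metis insert_iff)
      then show ?thesis by blast
    next
      case False
      then show ?thesis using x by blast
    qed
  qed simp
  obtain x0 where x0: "x0 \<in> A" "\<forall>y\<in>A. (x0, y) \<in> r\<inverse> \<longrightarrow> y = x0"
    using ex[of A "r\<inverse>"] ne r_trans r_antisym by blast
  obtain x1 where x1: "x1 \<in> A" "(x0, x1) \<in> r" "\<forall>y\<in>{y\<in>A. (x0, y) \<in> r}. (x1, y) \<in> r \<longrightarrow> y = x1"
    using ex[of "{y\<in>A. (x0, y) \<in> r}" r] x0(1) r_refl r_trans r_antisym by blast
  show thesis
    using that[of x0 x1] x0 x1 r_trans by blast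
qed

text \<open>A minimal element of the complement of a down-set can be added to it.\<close>

lemma ex_down_set:
  assumes "k \<le> card A"
  shows "\<exists>S\<subseteq>A. card S = k \<and> (\<forall>x\<in>A. \<forall>y\<in>S. (x, y) \<in> r \<longrightarrow> x \<in> S)"
  using assms
proof (induction k)
  case 0
  then show ?case by (intro exI[of _ "{}"]) simp
next
  case (Suc k)
  then obtain S where S: "S \<subseteq> A" "card S = k" "\<forall>x\<in>A. \<forall>y\<in>S. (x, y) \<in> r \<longrightarrow> x \<in> S" by auto
  interpret T: finite_poset "A - S" "Restr r (A - S)"
  proof
    show "A - S \<noteq> {}" using Suc.prems S(1,2) by auto
    show "partial_order_on (A - S) (Restr r (A - S))"
      unfolding order_on_defs refl_on_def
      by (intro conjI transI antisymI) (auto intro: r_refl r_trans r_antisym)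
  qed (use fin in simp)
  obtain x0 where x0: "x0 \<in> A - S" "\<And>v. v \<in> A - S \<Longrightarrow> (v, x0) \<in> Restr r (A - S) \<Longrightarrow> v = x0"
    using T.ex_min_below_max by metis
  have "card (insert x0 S) = Suc k" using S x0(1) fin by (metis DiffD2 card_insert_disjoint finite_subset)
  moreover have "\<forall>x\<in>A. \<forall>y\<in>insert x0 S. (x, y) \<in> r \<longrightarrow> x \<in> insert x0 S"
    using S(3) x0 by blast
  ultimately show ?case using S(1) x0(1) by (intro exI[of _ "insert x0 S"]) blast
qed

end

lemma partition_into_blocks:
  assumes "finite X" "p dvd card X" "p > 0"
  shows "\<exists>\<G>. partition_on X \<G> \<and> (\<forall>G\<in>\<G>. card G = p)"
  using assms(1,2)
proof (induction "card X" arbitrary: X rule: less_induct)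
  case less
  show ?case
  proof (cases "X = {}")
    case True
    then show ?thesis by (intro exI[of _ "{}"]) (simp add: partition_on_def)
  next
    case False
    then have "p \<le> card X" using less.prems by (metis card_0_eq dvd_imp_le gr0I)
    then obtain G where G: "G \<subseteq> X" "card G = p" by (meson obtain_subset_with_card_n)
    have fG: "finite G" using G less.prems finite_subset by blast
    have "card (X - G) = card X - p" using G fG by (simp add: card_Diff_subset)
    then obtain \<G> where g: "partition_on (X - G) \<G>" "\<forall>G\<in>\<G>. card G = p"
      using less.hyps[of "X - G"] less.prems \<open>p \<le> card X\<close> assms(3) by (auto simp: dvd_diff_nat)
    have "partition_on (G \<union> (X - G)) (insert G \<G>)"
      using g(1) G assms(3) unfolding partition_on_def disjoint_def by auto
    moreover have "G \<union> (X - G) = X" using G(1) by blast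
    ultimately show ?thesis using g(2) G(2) by (metis insert_iff)
  qed
qed

section \<open>Grouping the points of a punctured cube\<close>

text \<open>Peel off a vertex of maximal rank and complete its last block with elements of the fibre of its parent.\<close>

lemma partition_tree_fibres:
  fixes f :: "'v \<Rightarrow> 'l set" and rank :: "'v \<Rightarrow> nat"
  assumes "finite V" "root \<in> V" "p > 0"
    and "\<And>v. v \<in> V \<Longrightarrow> v \<noteq> root \<Longrightarrow> par v \<in> V \<and> rank (par v) < rank v"
    and "\<And>v. v \<in> V \<Longrightarrow> finite (f v) \<and> p * card V \<le> card (f v)"
    and "p dvd card (Sigma V f)"
  shows "\<exists>\<G>. partition_on (Sigma V f) \<G> \<and>
    (\<forall>G\<in>\<G>. card G = p \<and> (fst ` G \<subseteq> {root} \<or> (\<exists>v\<in>V - {root}. fst ` G \<subseteq> {v, par v})))"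
  using assms
proof (induction "card V" arbitrary: V f rule: less_induct)
  case less
  have finS: "finite (Sigma V f)" using less.prems(1,5) by blast
  show ?case
  proof (cases "V = {root}")
    case True
    obtain \<G> where \<G>: "partition_on (Sigma V f) \<G>" "\<forall>G\<in>\<G>. card G = p"
      using partition_into_blocks[OF finS less.prems(6,3)] by blast
    have "fst ` G \<subseteq> {root}" if "G \<in> \<G>" for G
      using partition_onD1[OF \<G>(1)] that True by fastforce
    then show ?thesis using \<G> by blast
  next
    case False
    then have "V - {root} \<noteq> {}" using less.prems(2) by blast
    then have "Max (rank ` (V - {root})) \<in> rank ` (V - {root})"
      using less.prems(1) by (intro Max_in) auto
    then obtain v where "v \<in> V - {root}" "Max (rank ` (V - {root})) = rank v" by blast
    then have v: "v \<in> V" "v \<noteq> root" "\<And>u. u \<in> V \<Longrightarrow> u \<noteq> root \<Longrightarrow> rank u \<le> rank v"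
      using less.prems(1) by (auto simp flip: \<open>Max _ = _\<close> intro!: Max_ge)
    define u where "u = par v"
    have u: "u \<in> V" "rank u < rank v" using less.prems(4) v u_def by auto
    then have "u \<noteq> v" by blast
    \<comment> \<open>\<open>h\<close> elements fill up the last block of the fibre of
      \<open>v\<close>; the outer \<open>mod\<close> gives 0 when that fibre already splits into
      blocks.\<close>
    define h where "h = (p - card (f v) mod p) mod p"
    have "h < p" using less.prems(3) h_def by simp
    moreover have "p \<le> p * card V" using less.prems(1,2) by (cases "card V") auto
    ultimately obtain H where H: "H \<subseteq> f u" "card H = h"
      using less.prems(5)[OF u(1)] by (meson le_trans less_imp_le_nat obtain_subset_with_card_n)
    have finH: "finite H" using H less.prems(5)[OF u(1)] finite_subset by blast
    define Y where "Y = {v} \<times> f v \<union> {u} \<times> H"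
    have finY: "finite Y" using finH less.prems(5) v by (simp add: Y_def)
    have "card Y = card (f v) + h"
      unfolding Y_def using \<open>u \<noteq> v\<close> less.prems(5) v finH H(2)
      by (subst card_Un_disjoint) (auto simp: card_cartesian_product)
    moreover have "p dvd card (f v) + h"
    proof -
      have "(card (f v) + h) mod p = (card (f v) mod p + (p - card (f v) mod p)) mod p"
        unfolding h_def by (simp add: mod_simps)
      also have "\<dots> = 0" using less.prems(3) by simp
      finally show ?thesis by presburger
    qed
    ultimately have pY: "p dvd card Y" by simp
    obtain \<G>1 where \<G>1: "partition_on Y \<G>1" "\<forall>G\<in>\<G>1. card G = p"
      using partition_into_blocks[OF finY pY less.prems(3)] by blast
    define V' where "V' = V - {v}"
    \<comment> \<open>The fibre of \<open>u\<close> loses fewer than \<open>p\<close> elements while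
      the tree loses a vertex, so the bound \<open>p * card V\<close> persists.\<close>
    define f' where "f' = f(u := f u - H)"
    have split: "Sigma V f = Y \<union> Sigma V' f'" "Y \<inter> Sigma V' f' = {}"
      using v u H \<open>u \<noteq> v\<close> by (auto simp: Y_def V'_def f'_def split: if_splits)
    have fin': "finite (Sigma V' f')" using finS split(1) by (metis finite_Un)
    have "card (Sigma V f) = card Y + card (Sigma V' f')"
      using split finY fin' by (simp add: card_Un_disjoint)
    then have p': "p dvd card (Sigma V' f')"
      using less.prems(6) pY by (metis dvd_add_right_iff)
    have cV: "card V = Suc (card V')" unfolding V'_def using less.prems(1) v(1) by (rule card.remove)
    have "\<exists>\<G>. partition_on (Sigma V' f') \<G> \<and>
      (\<forall>G\<in>\<G>. card G = p \<and> (fst ` G \<subseteq> {root} \<or> (\<exists>v\<in>V' - {root}. fst ` G \<subseteq> {v, par v})))"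
    proof (rule less.hyps[OF _ _ _ less.prems(3)])
      show "par w \<in> V' \<and> rank (par w) < rank w" if "w \<in> V'" "w \<noteq> root" for w
      proof -
        have "par w \<in> V" "rank (par w) < rank w" "rank w \<le> rank v"
          using less.prems(4) that v(3) by (auto simp: V'_def)
        then show ?thesis by (auto simp: V'_def)
      qed
      show "finite (f' w) \<and> p * card V' \<le> card (f' w)" if "w \<in> V'" for w
      proof -
        have "w \<in> V" using that by (simp add: V'_def)
        then have "finite (f w)" "p * card V' + p \<le> card (f w)"
          using less.prems(5)[of w] cV by auto
        then show ?thesis
          using H finH \<open>h < p\<close> by (auto simp: f'_def card_Diff_subset)
      qed
      show "card V' < card V" using cV by simp
      show "finite V'" "root \<in> V'" using less.prems(1,2) v(2) by (auto simp: V'_def)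
    qed (fact p')
    then obtain \<G>2 where \<G>2: "partition_on (Sigma V' f') \<G>2"
      "\<forall>G\<in>\<G>2. card G = p \<and> (fst ` G \<subseteq> {root} \<or> (\<exists>v\<in>V' - {root}. fst ` G \<subseteq> {v, par v}))"
      by blast
    have "partition_on (Sigma V f) (\<G>1 \<union> \<G>2)"
      using \<G>1(1) \<G>2(1) split unfolding partition_on_def by (auto intro!: disjoint_union)
    moreover have "fst ` G \<subseteq> {v, par v}" if "G \<in> \<G>1" for G
    proof -
      have "G \<subseteq> Y" using partition_onD1[OF \<G>1(1)] that by blast
      then show ?thesis by (auto simp: Y_def u_def)
    qed
    moreover have "V' - {root} \<subseteq> V - {root}" "v \<in> V - {root}" using v(1,2) by (auto simp: V'_def)
    ultimately have "card G = p \<and> (fst ` G \<subseteq> {root} \<or> (\<exists>v\<in>V - {root}. fst ` G \<subseteq> {v, par v}))"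
      if "G \<in> \<G>1 \<union> \<G>2" for G
      using \<G>1(2) \<G>2(2) that by (metis Un_iff subsetD)
    then show ?thesis using \<open>partition_on (Sigma V f) (\<G>1 \<union> \<G>2)\<close> by blast
  qed
qed

text \<open>The punctured cube carries a tree in which a vertex and its parent share an element
  \<open>i\<close> and both miss an element \<open>j\<close>. Blocks living over a vertex and its
  parent inherit \<open>i\<close> and \<open>j\<close>.\<close>

lemma partition_punctured_cube:
  fixes m l p :: nat
  assumes m: "m \<ge> 3" and p: "p > 0" "p dvd (2 ^ m - 2) * 2 ^ l" and l: "p * 2 ^ m \<le> 2 ^ l"
  defines "V \<equiv> Pow {..<m} - {{}, {..<m}}"
  shows "\<exists>\<G>. partition_on (V \<times> Pow {..<l}) \<G> \<and>
    (\<forall>G\<in>\<G>. card G = p \<and> (\<exists>i<m. \<exists>j<m. i \<noteq> j \<and> (\<forall>x\<in>G. i \<in> fst x \<and> j \<notin> fst x)))"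
proof -
  \<comment> \<open>The root is \<open>{0}\<close>. Sets containing 0 lose their maximum, the others
    gain 0. Only the complement of \<open>{0}\<close> would become the full set, so it loses 1
    instead; \<open>rank\<close> makes it the highest vertex.\<close>
  define par where "par = (\<lambda>d::nat set. if 0 \<in> d then d - {Max d}
    else if insert 0 d \<noteq> {..<m} then insert 0 d else d - {1})"
  define rank where "rank = (\<lambda>d::nat set. if 0 \<in> d then card d
    else if insert 0 d \<noteq> {..<m} then m + 1 else m + 2)"
  have finV: "finite V" by (simp add: V_def)
  have cV: "card V = 2 ^ m - 2"
  proof -
    have "0 \<in> {..<m}" using m by simp
    then have "{} \<noteq> {..<m}" by blast
    moreover have "card V = card (Pow {..<m}) - card {{}, {..<m}}"
      unfolding V_def by (intro card_Diff_subset) auto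
    ultimately show ?thesis by (simp add: card_Pow)
  qed
  have key: "par v \<in> V \<and> rank (par v) < rank v \<and> v \<inter> par v \<noteq> {} \<and> v \<union> par v \<noteq> {..<m}"
    if v: "v \<in> V" "v \<noteq> {0}" for v
  proof -
    have fv: "finite v" "v \<subseteq> {..<m}" "v \<noteq> {}" "v \<noteq> {..<m}" using v by (auto simp: V_def intro: finite_subset)
    then have "card v \<le> m" using card_mono[of "{..<m}" v] by simp
    consider "0 \<in> v" | "0 \<notin> v" "insert 0 v \<noteq> {..<m}" | "0 \<notin> v" "insert 0 v = {..<m}" by blast
    then show ?thesis
    proof cases
      case 1
      have "Max v \<noteq> 0"
      proof
        assume "Max v = 0"
        then have "v \<subseteq> {0}" using Max_ge[OF fv(1)] by fastforce
        then show False using v(2) 1 by blast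
      qed
      moreover have "Max v \<in> v" using fv by simp
      ultimately have par: "par v = v - {Max v}" "0 \<in> v - {Max v}" "card (v - {Max v}) < card v"
        using 1 card_Diff1_less[OF fv(1)] by (auto simp: par_def)
      define w where "w = v - {Max v}"
      have w: "w \<subseteq> v" "Max v \<notin> w" "par v = w" "0 \<in> w" "card w < card v"
        using par by (auto simp: w_def)
      then have "w \<noteq> {..<m}" using fv(2) \<open>Max v \<in> v\<close> by blast
      moreover have "w \<subseteq> {..<m}" "v \<union> w = v" "0 \<in> v \<inter> w" using w fv(2) 1 by blast+
      moreover have "rank v = card v" "rank w = card w" using w(4) 1 by (simp_all add: rank_def)
      ultimately have "w \<in> V" "rank w < rank v" "v \<inter> w \<noteq> {}" "v \<union> w \<noteq> {..<m}"
        unfolding V_def using w(4,5) fv(4) by auto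
      then show ?thesis unfolding w(3) by (intro conjI)
    next
      case 2
      then have "card (insert 0 v) \<le> m" using fv card_mono[of "{..<m}" "insert 0 v"] m by auto
      moreover define w where "w = insert 0 v"
      ultimately have w: "v \<subseteq> w" "0 \<in> w" "w \<noteq> {..<m}" "card w \<le> m" "par v = w"
        using 2 by (auto simp: par_def)
      have "0 < m" using m by simp
      then have "w \<subseteq> {..<m}" using fv(2) by (simp add: w_def)
      moreover have "w \<noteq> {}" "v \<inter> w \<noteq> {}" "v \<union> w = w" using w(1,2) fv(3) by blast+
      moreover have "rank v = m + 1" using 2 by (simp add: rank_def)
      moreover have "rank w = card w" using w(2) by (simp add: rank_def)
      ultimately have "w \<in> V" "rank w < rank v" "v \<inter> w \<noteq> {}" "v \<union> w \<noteq> {..<m}"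
        unfolding V_def using w(3,4) by simp_all
      then show ?thesis unfolding w(5) by (intro conjI)
    next
      case 3
      have "1 \<in> insert 0 v" "2 \<in> insert 0 v" unfolding 3(2) using m by simp_all
      then have v12: "1 \<in> v" "2 \<in> v" by simp_all
      define w where "w = v - {1}"
      have w: "w \<subseteq> v" "1 \<notin> insert 0 w" "2 \<in> w" "0 \<notin> w" "par v = w"
        using v12 3 by (auto simp: w_def par_def)
      have "1 \<in> {..<m}" using m by simp
      then have n: "insert 0 w \<noteq> {..<m}" "w \<noteq> {..<m}" using w(2) by blast+
      have "w \<subseteq> {..<m}" "w \<noteq> {}" "v \<inter> w \<noteq> {}" "v \<union> w = v" using w(1,3) v12 fv(2) by blast+
      moreover have "rank v = m + 2" using 3 by (simp add: rank_def)
      moreover have "rank w = m + 1" using w(4) n(1) by (simp add: rank_def)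
      moreover have "m + 1 < m + 2" by simp
      ultimately have "w \<in> V" "rank w < rank v" "v \<inter> w \<noteq> {}" "v \<union> w \<noteq> {..<m}"
        unfolding V_def using n(2) fv(4) by simp_all
      then show ?thesis unfolding w(5) by (intro conjI)
    qed
  qed
  have "1 \<in> {..<m}" "1 \<notin> {0::nat}" using m by auto
  then have neq: "{0} \<noteq> {..<m}" by blast
  moreover have "{0} \<subseteq> {..<m}" using m by simp
  ultimately have root: "{0} \<in> V" by (simp add: V_def)
  have "\<exists>\<G>. partition_on (Sigma V (\<lambda>_. Pow {..<l})) \<G> \<and>
    (\<forall>G\<in>\<G>. card G = p \<and> (fst ` G \<subseteq> {{0}} \<or> (\<exists>v\<in>V - {{0}}. fst ` G \<subseteq> {v, par v})))"
  proof (rule partition_tree_fibres[where rank = rank])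
    have "p * card V \<le> p * 2 ^ m" using cV by simp
    then have "p * card V \<le> 2 ^ l" using l by linarith
    then show "finite (Pow {..<l}) \<and> p * card V \<le> card (Pow {..<l})" if "v \<in> V" for v
      by (simp add: card_Pow)
    show "p dvd card (V \<times> Pow {..<l})"
      using p(2) cV by (simp add: card_cartesian_product card_Pow)
  qed (use finV root p key in auto)
  then obtain \<G> where \<G>: "partition_on (V \<times> Pow {..<l}) \<G>"
    "\<forall>G\<in>\<G>. card G = p \<and> (fst ` G \<subseteq> {{0}} \<or> (\<exists>v\<in>V - {{0}}. fst ` G \<subseteq> {v, par v}))"
    by (elim exE conjE)
  have "\<exists>i<m. \<exists>j<m. i \<noteq> j \<and> (\<forall>x\<in>G. i \<in> fst x \<and> j \<notin> fst x)" if "G \<in> \<G>" for G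
  proof -
    have "\<exists>v\<in>V. \<exists>w\<in>V. fst ` G \<subseteq> {v, w} \<and> v \<inter> w \<noteq> {} \<and> v \<union> w \<noteq> {..<m}"
    proof (cases "fst ` G \<subseteq> {{0}}")
      case True
      then show ?thesis using root neq by (intro bexI[of _ "{0}"]) simp_all
    next
      case False
      then obtain v where "v \<in> V" "v \<noteq> {0}" "fst ` G \<subseteq> {v, par v}"
        using bspec[OF \<G>(2) \<open>G \<in> \<G>\<close>] by (metis DiffE singletonI)
      then show ?thesis using key[of v] by (intro bexI[of _ v] bexI[of _ "par v"]) simp_all
    qed
    then obtain v w where vw: "v \<in> V" "w \<in> V" "fst ` G \<subseteq> {v, w}" "v \<inter> w \<noteq> {}" "v \<union> w \<noteq> {..<m}"
      by (elim bexE conjE)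
    have sub: "v \<subseteq> {..<m}" "w \<subseteq> {..<m}" using vw(1,2) by (simp_all add: V_def)
    obtain i where i: "i \<in> v" "i \<in> w" using vw(4) by blast
    obtain j where j: "j < m" "j \<notin> v" "j \<notin> w" using sub vw(5) by blast
    have "i < m" using i sub by blast
    moreover have "fst x = v \<or> fst x = w" if "x \<in> G" for x using vw(3) that by blast
    ultimately show ?thesis using i j by metis
  qed
  then show ?thesis using \<G> by (intro exI[of _ \<G>]) simp
qed

text \<open>By pigeonhole two powers of 4 agree modulo \<open>p\<close>, so \<open>p\<close> divides
  a power of 2 times \<open>2 ^ (m - 1) - 1\<close>. Using even exponents only ensures
  \<open>m \<ge> 3\<close>.\<close>

lemma ex_dvd_punctured_cube:
  fixes p :: nat
  assumes "p > 0"
  shows "\<exists>m\<ge>3. \<exists>l0. \<forall>l\<ge>l0. p dvd (2 ^ m - 2) * 2 ^ l"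
proof -
  have "\<not> inj_on (\<lambda>j::nat. (2::nat) ^ (2 * j) mod p) {..p}"
  proof
    assume "inj_on (\<lambda>j::nat. (2::nat) ^ (2 * j) mod p) {..p}"
    then have "card {..p} \<le> card {..<p}"
      by (rule card_inj_on_le) (use assms in auto)
    then show False by simp
  qed
  then obtain a b :: nat where "a \<noteq> b" "(2::nat) ^ (2 * a) mod p = 2 ^ (2 * b) mod p"
    by (auto simp: inj_on_def)
  then obtain i j :: nat where ij: "i < j" "(2::nat) ^ (2 * j) mod p = 2 ^ (2 * i) mod p"
    by (metis nat_neq_iff)
  define m where "m = 2 * (j - i) + 1"
  have e: "2 * i + (m - 1) = 2 * j" using ij(1) by (simp add: m_def)
  have "p dvd 2 ^ (2 * j) - 2 ^ (2 * i)"
    using ij by (simp add: mod_eq_dvd_iff_nat)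
  moreover have "(2::nat) ^ (2 * j) - 2 ^ (2 * i) = 2 ^ (2 * i) * (2 ^ (m - 1) - 1)"
    by (simp add: diff_mult_distrib2 flip: e power_add)
  ultimately have d: "p dvd 2 ^ (2 * i) * (2 ^ (m - 1) - 1)" by simp
  have "p dvd (2 ^ m - 2) * 2 ^ l" if "l \<ge> 2 * i" for l
  proof -
    have "(2::nat) ^ m - 2 = 2 * (2 ^ (m - 1) - 1)"
      by (simp add: m_def)
    then have "(2 ^ m - 2) * (2::nat) ^ l = 2 ^ (2 * i) * (2 ^ (m - 1) - 1) * (2 * 2 ^ (l - 2 * i))"
      using that by (simp add: mult_ac flip: power_add)
    then show ?thesis using d by (metis dvd_mult2)
  qed
  moreover have "m \<ge> 3" using ij(1) by (simp add: m_def)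
  ultimately show ?thesis by blast
qed

section \<open>Absorbing words over a finite alphabet\<close>

lemma mod_add_left_cancel_less:
  fixes s a b n :: nat
  assumes "(s + a) mod n = (s + b) mod n" "a < n" "b < n"
  shows "a = b"
proof -
  have *: "x = y" if "(s + x) mod n = (s + y) mod n" "x \<le> y" "y < n" for x y
  proof -
    have "n dvd (s + y) - (s + x)"
      using that by (subst mod_eq_dvd_iff_nat[symmetric]) auto
    then have "n dvd y - x" by simp
    then show ?thesis using that by (metis diff_diff_cancel diff_zero dvd_imp_le less_imp_diff_less linorder_not_less neq0_conv)
  qed
  show ?thesis
    using *[of a b] *[of b a] assms by (metis nat_le_linear)
qed

lemma fun_upd_le_iff: "w(i := a) \<le> w(i := b) \<longleftrightarrow> a \<le> b" for w :: "'i \<Rightarrow> 'b::order"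
  by (auto simp: le_fun_def dest: spec[of _ i])

text \<open>Each \<open>B f\<close> is a copy of the square of the poset among the letters
  \<open>S\<close>; \<open>blk\<close> assigns to a letter outside \<open>Act\<close> a block wholly
  above it (\<open>up\<close>) or wholly below it. The pairs \<open>h1\<close>, \<open>l1\<close>
  and \<open>h2\<close>, \<open>l2\<close> allow a group to be compared with some cells of a column
  and not with others. The bound on \<open>N\<close> leaves enough positions for a checksum that
  separates letters and groups.\<close>

locale absorption = finite_poset A r for A :: "'a set" and r :: "'a rel" +
  fixes Q :: "'q::order set" and S :: "'s::order set"
    and F :: "'f set" and B :: "'f \<Rightarrow> 'a \<Rightarrow> 'a \<Rightarrow> 's" and up :: "'f \<Rightarrow> bool"
    and blk :: "'s \<Rightarrow> 'f" and Act :: "'s set"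
    and \<G> :: "'q set set" and h1 l1 h2 l2 :: "'q set \<Rightarrow> 'q" and N :: nat
  assumes Act_def: "Act = {B f v u | f v u. f \<in> F \<and> v \<in> A \<and> u \<in> A}"
    and fin_S: "finite S"
    and B_le: "\<And>f v u v' u'. f \<in> F \<Longrightarrow> v \<in> A \<Longrightarrow> u \<in> A \<Longrightarrow> v' \<in> A \<Longrightarrow> u' \<in> A \<Longrightarrow>
      B f v u \<le> B f v' u' \<longleftrightarrow> (v, v') \<in> r \<and> (u, u') \<in> r"
    and B_block: "\<And>f g v u v' u'. f \<in> F \<Longrightarrow> g \<in> F \<Longrightarrow> v \<in> A \<Longrightarrow> u \<in> A \<Longrightarrow> v' \<in> A \<Longrightarrow> u' \<in> A \<Longrightarrow>
      B f v u = B g v' u' \<Longrightarrow> f = g"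
    and Act_sub: "Act \<subseteq> S"
    and blk: "\<And>b. b \<in> S \<Longrightarrow> b \<notin> Act \<Longrightarrow> blk b \<in> F"
    and blk_up: "\<And>b v u. b \<in> S \<Longrightarrow> b \<notin> Act \<Longrightarrow> up (blk b) \<Longrightarrow> v \<in> A \<Longrightarrow> u \<in> A \<Longrightarrow> b \<le> B (blk b) v u"
    and blk_dn: "\<And>b v u. b \<in> S \<Longrightarrow> b \<notin> Act \<Longrightarrow> \<not> up (blk b) \<Longrightarrow> v \<in> A \<Longrightarrow> u \<in> A \<Longrightarrow> B (blk b) v u \<le> b"
    and part: "partition_on Q \<G>" and fin_G: "finite \<G>"
    and card_G: "\<And>G. G \<in> \<G> \<Longrightarrow> card G = card A"
    and hl1: "\<And>G. G \<in> \<G> \<Longrightarrow> h1 G \<in> Q \<and> l1 G \<in> Q \<and> l1 G \<le> h1 G \<and> (\<forall>d\<in>G. d \<le> h1 G \<and> \<not> d \<le> l1 G)"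
    and hl2: "\<And>G. G \<in> \<G> \<Longrightarrow> h2 G \<in> Q \<and> l2 G \<in> Q \<and> l2 G \<le> h2 G \<and> (\<forall>d\<in>G. l2 G \<le> d \<and> \<not> h2 G \<le> d)"
    and N: "2 * card S * card \<G> \<le> N" and N_pos: "N > 0"
begin

section \<open>Leftover words, their majority type and the checksum position\<close>

definition W where "W = (Pi\<^sub>E {..<N} (\<lambda>_. S))"

definition W0 where "W0 = {w \<in> W. \<forall>i<N. w i \<notin> Act}"

definition U where "U c w = {i. i < N \<and> up (blk (w i)) = c}"

text \<open>A type shared by at least half of the positions; a tie counts as
  \<open>True\<close>.\<close>

definition tp where "tp w \<longleftrightarrow> N \<le> 2 * card (U True w)"

lemma card_U: "N \<le> 2 * card (U (tp w) w)"
proof (cases "tp w")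
  case False
  have "card (U True w) + card (U False w) = card (U True w \<union> U False w)"
    by (subst card_Un_disjoint) (auto simp: U_def)
  also have "U True w \<union> U False w = {..<N}" by (auto simp: U_def)
  finally show ?thesis using False by (simp add: tp_def)
qed (simp add: tp_def)

lemma finite_U: "finite (U c w)"
  by (simp add: U_def)

definition num where "num = (SOME f. bij_betw f S {0..<card S})"

definition gi where "gi = (SOME f. bij_betw f \<G> {0..<card \<G>})"

text \<open>The enumeration depends on the set alone, so words with the same \<open>U\<close> share
  it and equal positions give equal checksums.\<close>

definition en where "en = (SOME f. \<forall>X :: nat set. finite X \<longrightarrow> bij_betw (f X) {0..<card X} X)"

lemma num: "bij_betw num S {0..<card S}"
  using someI_ex[OF ex_bij_betw_finite_nat[OF fin_S]] unfolding num_def .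

lemma gi: "bij_betw gi \<G> {0..<card \<G>}"
  using someI_ex[OF ex_bij_betw_finite_nat[OF fin_G]] unfolding gi_def .

lemma en: "finite X \<Longrightarrow> bij_betw (en X) {0..<card X} X"
proof -
  have "\<exists>f. \<forall>X :: nat set. finite X \<longrightarrow> bij_betw (f X) {0..<card X} X"
    using ex_bij_betw_nat_finite by metis
  then have "\<forall>X :: nat set. finite X \<longrightarrow> bij_betw (en X) {0..<card X} X"
    unfolding en_def by (rule someI_ex)
  then show "finite X \<Longrightarrow> bij_betw (en X) {0..<card X} X" by blast
qed

text \<open>
  The position \<open>pos w G\<close> is a checksum of the letters of the majority type and of the group. Since the blocks
  for the two types of letters differ, the type of the overwritten letter is known, hence so is
  \<open>U\<close>, and the checksum yields the overwritten letter together with \<open>G\<close>.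
\<close>

definition idx where "idx w G = ((\<Sum>i\<in>U (tp w) w. num (w i) * card \<G>) + gi G) mod card (U (tp w) w)"

definition pos where "pos w G = en (U (tp w) w) (idx w G)"

lemma card_U_pos: "card (U (tp w) w) > 0"
  using card_U[of w] N_pos by auto

lemma pos_in: "pos w G \<in> U (tp w) w"
proof -
  have "idx w G \<in> {0..<card (U (tp w) w)}" using card_U_pos by (simp add: idx_def)
  then show ?thesis unfolding pos_def using bij_betwE[OF en[OF finite_U]] by blast
qed

lemma pos_less: "pos w G < N"
  using pos_in[of w G] by (auto simp: U_def)

lemma up_pos: "up (blk (w (pos w G))) \<longleftrightarrow> tp w"
  using pos_in[of w G] by (auto simp: U_def)

lemma W0_D: "w \<in> W0 \<Longrightarrow> i < N \<Longrightarrow> w i \<in> S \<and> w i \<notin> Act"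
  by (auto simp: W0_def W_def)

lemma B_inj:
  assumes "f \<in> F" "g \<in> F" "v \<in> A" "u \<in> A" "v' \<in> A" "u' \<in> A" "B f v u = B g v' u'"
  shows "f = g \<and> v = v' \<and> u = u'"
proof -
  have "f = g" using B_block assms by blast
  moreover from this have "(v, v') \<in> r \<and> (u, u') \<in> r" "(v', v) \<in> r \<and> (u', u) \<in> r"
    using B_le[of f v u v' u'] B_le[of f v' u' v u] assms by auto
  ultimately show ?thesis using r_antisym by blast
qed

lemma B_Act: "f \<in> F \<Longrightarrow> v \<in> A \<Longrightarrow> u \<in> A \<Longrightarrow> B f v u \<in> Act"
  by (auto simp: Act_def)

definition bk where "bk w G = blk (w (pos w G))"

definition wd where "wd w G v u = w(pos w G := B (bk w G) v u)"

lemma bk_F: "w \<in> W0 \<Longrightarrow> bk w G \<in> F"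
  unfolding bk_def using W0_D[OF _ pos_less] blk by blast

lemma wd_active_iff:
  assumes "w \<in> W0" "v \<in> A" "u \<in> A" "i < N"
  shows "wd w G v u i \<in> Act \<longleftrightarrow> i = pos w G"
  using assms W0_D B_Act[OF bk_F] by (auto simp: wd_def)

lemma wd_W: "w \<in> W0 \<Longrightarrow> v \<in> A \<Longrightarrow> u \<in> A \<Longrightarrow> wd w G v u \<in> W"
  using B_Act[OF bk_F] Act_sub pos_less unfolding wd_def W0_def W_def
  by (auto simp: PiE_iff extensional_def)

text \<open>Decoding: the only active position is the checksum position, its letter shows the block,
  \<open>v\<close> and \<open>u\<close>, and the checksum returns the overwritten letter and the
  group.\<close>

lemma wd_inj:
  assumes w: "w \<in> W0" "w' \<in> W0" and G: "G \<in> \<G>" "G' \<in> \<G>"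
    and A: "v \<in> A" "u \<in> A" "v' \<in> A" "u' \<in> A" and eq: "wd w G v u = wd w' G' v' u'"
  shows "w = w' \<and> G = G' \<and> v = v' \<and> u = u'"
proof -
  let ?\<beta> = "pos w G"
  have \<beta>: "pos w' G' = ?\<beta>"
    using wd_active_iff[OF w(1) A(1,2) pos_less[of w G], of G]
      wd_active_iff[OF w(2) A(3,4) pos_less[of w G], of G'] eq by simp
  have "B (bk w G) v u = B (bk w' G') v' u'"
    using eq \<beta> unfolding wd_def by (metis fun_upd_same)
  then have B: "bk w G = bk w' G'" "v = v'" "u = u'"
    using B_inj[OF bk_F[OF w(1)] bk_F[OF w(2)] A] by auto
  have off: "w i = w' i" if "i \<noteq> ?\<beta>" for i
    using eq \<beta> that unfolding wd_def by (metis fun_upd_other)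
  have t: "tp w = tp w'"
    using B(1) up_pos[of w G] up_pos[of w' G'] by (simp add: bk_def)
  \<comment> \<open>At the position itself both words qualify by \<open>pos_in\<close>; elsewhere
    their letters agree.\<close>
  have U: "U (tp w) w = U (tp w') w'"
  proof (rule set_eqI)
    fix i
    show "i \<in> U (tp w) w \<longleftrightarrow> i \<in> U (tp w') w'"
      using off[of i] t pos_in[of w G] pos_in[of w' G'] \<beta> by (cases "i = ?\<beta>") (auto simp: U_def)
  qed
  let ?U = "U (tp w) w" and ?K = "card \<G>"
  have "idx w G = idx w' G'"
  proof (rule inj_onD)
    show "inj_on (en ?U) {0..<card ?U}" using en[OF finite_U] by (simp add: bij_betw_def)
    show "en ?U (idx w G) = en ?U (idx w' G')" using \<beta> U unfolding pos_def by simp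
  qed (use card_U_pos U in \<open>auto simp: idx_def\<close>)
  moreover define s where "s = (\<Sum>i\<in>?U - {?\<beta>}. num (w i) * ?K)"
  moreover have "(\<Sum>i\<in>?U. num (w i) * ?K) = num (w ?\<beta>) * ?K + s"
    unfolding s_def by (rule sum.remove[OF finite_U pos_in])
  moreover have "(\<Sum>i\<in>?U. num (w' i) * ?K) = num (w' ?\<beta>) * ?K + s"
    unfolding s_def sum.remove[OF finite_U pos_in[of w G]] using off by simp
  moreover have "idx w' G' = ((\<Sum>i\<in>?U. num (w' i) * ?K) + gi G') mod card ?U"
    by (simp add: idx_def U)
  ultimately have m: "(s + (num (w ?\<beta>) * ?K + gi G)) mod card ?U
      = (s + (num (w' ?\<beta>) * ?K + gi G')) mod card ?U"
    by (simp add: idx_def add_ac)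
  \<comment> \<open>The bound on \<open>N\<close> keeps the code of a letter and a group below the
    modulus, so it is recovered exactly.\<close>
  have lt: "num x * ?K + gi H < card ?U" "gi H < ?K" if "x \<in> S" "H \<in> \<G>" for x H
  proof -
    have "num x < card S" "gi H < ?K"
      using bij_betwE[OF num] bij_betwE[OF gi] that by auto
    moreover from this have "Suc (num x) * ?K \<le> card S * ?K" by (intro mult_right_mono) auto
    ultimately show "num x * ?K + gi H < card ?U" "gi H < ?K" using card_U[of w] N by auto
  qed
  have ws: "w ?\<beta> \<in> S" "w' ?\<beta> \<in> S" using W0_D w pos_less by auto
  have e: "num (w ?\<beta>) * ?K + gi G = num (w' ?\<beta>) * ?K + gi G'"
    using mod_add_left_cancel_less[OF m] lt ws G by blast
  \<comment> \<open>The code has \<open>num\<close> of the letter and \<open>gi\<close> of the group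
    as its digits in base \<open>card \<G>\<close>.\<close>
  have "gi G = gi G'"
    using arg_cong[OF e, of "\<lambda>x. x mod ?K"] lt(2) ws G by simp
  moreover from this have "num (w ?\<beta>) = num (w' ?\<beta>)"
    using e lt(2)[OF ws(1) G(1)] by simp
  ultimately have "G = G'" "w ?\<beta> = w' ?\<beta>"
    using gi num G ws by (auto simp: bij_betw_def dest: inj_onD)
  then show ?thesis using B off by (metis ext)
qed

section \<open>Columns that absorb the leftover words\<close>

definition x0 where "x0 = (SOME x. x \<in> A \<and> (\<forall>v\<in>A. (v, x) \<in> r \<longrightarrow> v = x))"
definition x1 where "x1 = (SOME x. x \<in> A \<and> (\<forall>v\<in>A. (x, v) \<in> r \<longrightarrow> v = x))"

lemma x0: "x0 \<in> A" "\<And>v. v \<in> A \<Longrightarrow> (v, x0) \<in> r \<Longrightarrow> v = x0"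
proof -
  have "x0 \<in> A \<and> (\<forall>v\<in>A. (v, x0) \<in> r \<longrightarrow> v = x0)"
    unfolding x0_def by (rule someI_ex) (metis ex_min_below_max)
  then show "x0 \<in> A" "\<And>v. v \<in> A \<Longrightarrow> (v, x0) \<in> r \<Longrightarrow> v = x0" by auto
qed

lemma x1: "x1 \<in> A" "\<And>v. v \<in> A \<Longrightarrow> (x1, v) \<in> r \<Longrightarrow> v = x1"
proof -
  have "x1 \<in> A \<and> (\<forall>v\<in>A. (x1, v) \<in> r \<longrightarrow> v = x1)"
    unfolding x1_def by (rule someI_ex) (metis ex_min_below_max)
  then show "x1 \<in> A" "\<And>v. v \<in> A \<Longrightarrow> (x1, v) \<in> r \<Longrightarrow> v = x1" by auto
qed

text \<open>The row whose cell gives way to the leftover point: minimal if the block lies above the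
  overwritten letter, maximal if below.\<close>

definition role where "role w = (if tp w then x0 else x1)"

text \<open>Chosen to be monotone in \<open>v\<close> and such that an element \<open>d\<close> of
  \<open>G\<close> satisfies \<open>d \<le> shift w G v\<close> exactly for \<open>v\<close> above
  \<open>x0\<close>, or dually \<open>shift w G v \<le> d\<close> exactly for \<open>v\<close> below
  \<open>x1\<close>.\<close>

definition shift where "shift w G v =
  (if tp w then if (x0, v) \<in> r then h1 G else l1 G else if (v, x1) \<in> r then l2 G else h2 G)"

definition cell where "cell w G v u = (shift w G v, wd w G v u)"

definition el where "el = (SOME f. \<forall>G\<in>\<G>. bij_betw (f G) A G)"

lemma el: "G \<in> \<G> \<Longrightarrow> bij_betw (el G) A G"
proof -
  have "\<forall>G\<in>\<G>. \<exists>f. bij_betw f A G"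
  proof
    fix G assume "G \<in> \<G>"
    then have "finite G" using card_G card_pos by (metis card.infinite less_numeral_extra(3))
    then show "\<exists>f. bij_betw f A G" using card_G \<open>G \<in> \<G>\<close> fin finite_same_card_bij by metis
  qed
  then have "\<exists>f. \<forall>G\<in>\<G>. bij_betw (f G) A G" by metis
  then have "\<forall>G\<in>\<G>. bij_betw (el G) A G" unfolding el_def by (rule someI_ex)
  then show "G \<in> \<G> \<Longrightarrow> bij_betw (el G) A G" by blast
qed

text \<open>Column \<open>u\<close> of the block, completed by a leftover point. The cells of row
  \<open>role w\<close> stay out and are tiled as a row.\<close>

definition col where "col w G u v = (if v = role w then (el G u, w) else cell w G v u)"

text \<open>The word \<open>w\<close> lies strictly below, or strictly above, all words of its
  block. So the leftover point compares with a cell in one direction only, and there the first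
  coordinates decide, through \<open>shift\<close>.\<close>

lemma emb_col:
  assumes w: "w \<in> W0" and G: "G \<in> \<G>" and u: "u \<in> A"
  shows "emb (col w G u)"
proof (rule embI)
  fix v v' assume v: "v \<in> A" "v' \<in> A"
  let ?\<beta> = "pos w G"
  have d: "el G u \<in> G" using bij_betwE[OF el[OF G]] u by blast
  have wb: "w ?\<beta> \<in> S" "w ?\<beta> \<notin> Act" using W0_D[OF w pos_less] by auto
  have ne: "w ?\<beta> \<noteq> B (bk w G) v u" if "v \<in> A" for v using B_Act[OF bk_F[OF w] that u] wb by metis
  have wd: "wd w G v u \<le> wd w G v' u \<longleftrightarrow> (v, v') \<in> r" if "v \<in> A" "v' \<in> A" for v v'
    using B_le[OF bk_F[OF w] that(1) u that(2) u] r_refl[OF u]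
    by (auto simp: wd_def le_fun_def)
  have role: "role w \<in> A" using x0 x1 by (simp add: role_def)
  show "(v, v') \<in> r \<longleftrightarrow> col w G u v \<le> col w G u v'"
  proof (cases "tp w")
    case True
    then have b: "w ?\<beta> \<le> B (bk w G) v u" if "v \<in> A" for v
      using blk_up[OF wb _ that u] up_pos[of w G] by (simp add: bk_def)
    have up: "w \<le> wd w G v u" "\<not> wd w G v u \<le> w" if "v \<in> A" for v
      using b[OF that] ne[OF that] by (auto simp: wd_def le_fun_def dest: order.antisym)
    have s: "el G u \<le> shift w G v \<longleftrightarrow> (x0, v) \<in> r" for v
      using hl1[OF G] d True by (auto simp: shift_def)
    have s2: "(v, v') \<in> r \<Longrightarrow> shift w G v \<le> shift w G v'" for v v'
      using hl1[OF G] True by (auto simp: shift_def dest: r_trans)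
    show ?thesis
      using True v up wd s s2 x0(2)[of v] r_refl[of x0] x0(1)
      by (auto simp: col_def role_def cell_def)
  next
    case False
    then have b: "B (bk w G) v u \<le> w ?\<beta>" if "v \<in> A" for v
      using blk_dn[OF wb _ that u] up_pos[of w G] by (simp add: bk_def)
    have dn: "wd w G v u \<le> w" "\<not> w \<le> wd w G v u" if "v \<in> A" for v
      using b[OF that] ne[OF that] by (auto simp: wd_def le_fun_def dest: order.antisym)
    have s: "shift w G v \<le> el G u \<longleftrightarrow> (v, x1) \<in> r" for v
      using hl2[OF G] d False by (auto simp: shift_def)
    have s2: "(v, v') \<in> r \<Longrightarrow> shift w G v \<le> shift w G v'" for v v'
      using hl2[OF G] False by (auto simp: shift_def dest: r_trans)
    show ?thesis
      using False v dn wd s s2 x1(2)[of v'] r_refl[of x1] x1(1)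
      by (auto simp: col_def role_def cell_def)
  qed
qed

text \<open>As \<open>u\<close> ranges freely and \<open>shift\<close> does not depend on it,
  \<open>C\<close> is a union of whole rows.\<close>

definition C where "C = {cell w G v u | w G v u. w \<in> W0 \<and> G \<in> \<G> \<and> v \<in> A - {role w} \<and> u \<in> A}"

text \<open>Cells of different columns are separated by \<open>wd_inj\<close>, leftover points by
  the partition \<open>\<G>\<close>, and a cell is never a leftover point because its word has an
  active letter.\<close>

lemma tile_columns: "tile (C \<union> Q \<times> W0)"
proof -
  let ?I = "W0 \<times> \<G> \<times> A"
  have act: "snd (cell w G v u) \<notin> W0" if "w \<in> W0" "v \<in> A" "u \<in> A" for w G v u
    using wd_active_iff[OF that pos_less] pos_less[of w G] by (auto simp: cell_def W0_def)
  have "tile (\<Union>(w, G, u)\<in>?I. col w G u ` A)"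
  proof (rule tile_UN)
    show "tile (case i of (w, G, u) \<Rightarrow> col w G u ` A)" if "i \<in> ?I" for i
      using that emb_col tile_emb by auto
    show "disjoint_family_on (\<lambda>i. case i of (w, G, u) \<Rightarrow> col w G u ` A) ?I"
      unfolding disjoint_family_on_def
    proof (intro ballI impI)
      fix i j assume "i \<in> ?I" "j \<in> ?I" "i \<noteq> j"
      moreover obtain w G u w' G' u' where "i = (w, G, u)" "j = (w', G', u')"
        by (metis prod_cases3)
      ultimately have i: "i = (w, G, u)" "j = (w', G', u')"
        "w \<in> W0" "w' \<in> W0" "G \<in> \<G>" "G' \<in> \<G>" "u \<in> A" "u' \<in> A" "(w, G, u) \<noteq> (w', G', u')"
        by simp_all
      have "col w G u v \<noteq> col w' G' u' v'" if v: "v \<in> A" "v' \<in> A" for v v'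
      proof
        assume eq: "col w G u v = col w' G' u' v'"
        consider "v = role w" "v' = role w'" | "v \<noteq> role w" "v' \<noteq> role w'"
          | "v = role w" "v' \<noteq> role w'" | "v \<noteq> role w" "v' = role w'" by blast
        then show False
        proof cases
          case 1
          then have "w = w'" "el G u = el G' u'" using eq by (auto simp: col_def)
          moreover have "el G u \<in> G" "el G' u' \<in> G'" using bij_betwE[OF el] i by auto
          moreover from calculation have "G = G'"
            using partition_onD2[OF part] i unfolding disjoint_def by auto
          ultimately show False
            using el[OF \<open>G \<in> \<G>\<close>] i unfolding bij_betw_def by (auto dest: inj_onD)
        next
          case 2
          then show False
            using eq wd_inj[OF i(3-6) v(1) i(7) v(2) i(8)] i(9) by (auto simp: col_def cell_def)
        next
          case 3
          then have "cell w' G' v' u' = (el G u, w)" using eq by (simp add: col_def)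
          then show False using act[OF i(4) v(2) i(8), of G'] i(3) by simp
        next
          case 4
          then have "cell w G v u = (el G' u', w')" using eq by (simp add: col_def)
          then show False using act[OF i(3) v(1) i(7), of G] i(4) by simp
        qed
      qed
      then show "(case i of (w, G, u) \<Rightarrow> col w G u ` A) \<inter> (case j of (w, G, u) \<Rightarrow> col w G u ` A) = {}"
        unfolding i(1,2) prod.case by blast
    qed
  qed
  also have "(\<Union>(w, G, u)\<in>?I. col w G u ` A) = C \<union> Q \<times> W0"
  proof
    show "(\<Union>(w, G, u)\<in>?I. col w G u ` A) \<subseteq> C \<union> Q \<times> W0"
    proof
      fix c assume "c \<in> (\<Union>(w, G, u)\<in>?I. col w G u ` A)"
      then obtain w G u v where h: "w \<in> W0" "G \<in> \<G>" "u \<in> A" "v \<in> A" "c = col w G u v"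
        by auto
      show "c \<in> C \<union> Q \<times> W0"
      proof (cases "v = role w")
        case True
        moreover have "el G u \<in> Q" using bij_betwE[OF el] partition_onD1[OF part] h by blast
        ultimately show ?thesis using h by (simp add: col_def)
      next
        case False
        then have "c = cell w G v u" "v \<in> A - {role w}" using h by (simp_all add: col_def)
        then show ?thesis using h unfolding C_def by blast
      qed
    qed
    show "C \<union> Q \<times> W0 \<subseteq> (\<Union>(w, G, u)\<in>?I. col w G u ` A)"
    proof (rule Un_least; rule subsetI)
      fix c assume "c \<in> C"
      then obtain w G v u where "c = cell w G v u" "w \<in> W0" "G \<in> \<G>" "v \<in> A - {role w}" "u \<in> A"
        unfolding C_def by blast
      then have "c = col w G u v" "w \<in> W0" "G \<in> \<G>" "v \<in> A" "u \<in> A"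
        by (simp_all add: col_def)
      then show "c \<in> (\<Union>(w, G, u)\<in>?I. col w G u ` A)" by auto
    next
      fix c assume "c \<in> Q \<times> W0"
      then obtain d w where c: "c = (d, w)" "d \<in> Q" "w \<in> W0" by blast
      then obtain G where G: "G \<in> \<G>" "d \<in> G" using partition_onD1[OF part] by blast
      then obtain u where u: "u \<in> A" "d = el G u" using el by (metis bij_betw_imp_surj_on imageE)
      then have "c = col w G u (role w)" using c by (simp add: col_def)
      moreover have "role w \<in> A" using x0 x1 by (simp add: role_def)
      ultimately show "c \<in> (\<Union>(w, G, u)\<in>?I. col w G u ` A)" using c G u by auto
    qed
  qed
  finally show ?thesis .
qed

section \<open>Rows at the first active letter\<close>

definition fv where "fv a = (SOME x. fst x \<in> F \<and> snd x \<in> A \<and> (\<exists>u\<in>A. a = B (fst x) (snd x) u))"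

lemma fv_B:
  assumes "f \<in> F" "v \<in> A" "u \<in> A"
  shows "fv (B f v u) = (f, v)"
proof -
  have "fst (fv (B f v u)) \<in> F \<and> snd (fv (B f v u)) \<in> A \<and>
    (\<exists>u'\<in>A. B f v u = B (fst (fv (B f v u))) (snd (fv (B f v u))) u')"
    unfolding fv_def[of "B f v u"] by (rule someI[of _ "(f, v)"]) (use assms in auto)
  then show ?thesis using B_inj assms by (metis prod.collapse)
qed

definition ac where "ac w = (LEAST i. i < N \<and> w i \<in> Act)"

text \<open>The row through \<open>x\<close>: only the second block coordinate of the first active
  letter varies.\<close>

definition row :: "'q \<times> (nat \<Rightarrow> 's) \<Rightarrow> ('q \<times> (nat \<Rightarrow> 's)) set" where
  "row x = (\<lambda>u. (fst x, (snd x)(ac (snd x) := case fv (snd x (ac (snd x))) of (f, v) \<Rightarrow> B f v u))) ` A"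

text \<open>Moving along the row changes neither the first active position nor the block nor
  \<open>v\<close>, so all members of a row have the same row.\<close>

lemma row_unfold:
  assumes "w \<in> W - W0"
  obtains i f v u where "i < N" "f \<in> F" "v \<in> A" "u \<in> A" "w i = B f v u" "ac w = i"
    "\<And>q u'. u' \<in> A \<Longrightarrow> row (q, w(i := B f v u')) = (\<lambda>u. (q, w(i := B f v u))) ` A"
proof -
  have "\<exists>i. i < N \<and> w i \<in> Act" using assms by (auto simp: W0_def)
  then have i: "ac w < N" "w (ac w) \<in> Act"
    unfolding ac_def using LeastI_ex[of "\<lambda>i. i < N \<and> w i \<in> Act"] by auto
  have less: "\<not> w j \<in> Act" if "j < ac w" for j
    using not_less_Least[of j "\<lambda>i. i < N \<and> w i \<in> Act"] that i(1) unfolding ac_def by auto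
  obtain f v u where B: "f \<in> F" "v \<in> A" "u \<in> A" "w (ac w) = B f v u"
    using i(2) by (auto simp: Act_def)
  have "row (q, w(ac w := B f v u')) = (\<lambda>u. (q, w(ac w := B f v u))) ` A" if "u' \<in> A" for q u'
  proof -
    have "ac (w(ac w := B f v u')) = ac w"
      unfolding ac_def[of "w(ac w := B f v u')"]
      by (rule Least_equality) (use i less B_Act B that in \<open>auto simp: not_less[symmetric]\<close>)
    then show ?thesis using fv_B[OF B(1,2) that] by (simp add: row_def)
  qed
  then show thesis using that i(1) B by blast
qed

lemma tile_rows: "tile (Q \<times> (W - W0) - C)"
proof (rule tile_classes[where c = row])
  fix x assume x: "x \<in> Q \<times> (W - W0) - C"
  then obtain q w where qw: "x = (q, w)" "q \<in> Q" "w \<in> W - W0" "(q, w) \<notin> C" by blast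
  obtain i f v u where i: "i < N" "f \<in> F" "v \<in> A" "u \<in> A" "w i = B f v u" "ac w = i"
    and row: "\<And>q u'. u' \<in> A \<Longrightarrow> row (q, w(i := B f v u')) = (\<lambda>u. (q, w(i := B f v u))) ` A"
    using row_unfold[OF qw(3)] by metis
  have wi: "w(i := B f v u) = w" using i by auto
  have rx: "row x = (\<lambda>u. (q, w(i := B f v u))) ` A"
    using row[OF i(4), of q] wi qw(1) by simp
  have "emb (\<lambda>u. (q, w(i := B f v u)))"
    using B_le[OF i(2,3) _ i(3)] r_refl[OF i(3)] by (intro embI) (simp add: fun_upd_le_iff)
  then show "\<exists>f. emb f \<and> row x = f ` A" using rx by blast
  show "x \<in> row x" using rx wi qw(1) i(4) by (metis imageI)
  show "row x \<subseteq> Q \<times> (W - W0) - C"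
  proof
    fix y assume "y \<in> row x"
    then obtain u' where u': "u' \<in> A" "y = (q, w(i := B f v u'))" using rx by blast
    have "w(i := B f v u') \<in> W - W0"
      using qw(3) B_Act[OF i(2,3) u'(1)] Act_sub i(1)
      by (auto simp: W_def W0_def PiE_iff extensional_def)
    \<comment> \<open>Membership of \<open>y\<close> in \<open>C\<close> makes \<open>i\<close> the
      checksum position of some \<open>w1\<close>; changing \<open>u'\<close> back to
      \<open>u\<close> stays in \<open>C\<close>, against the choice of \<open>x\<close>.\<close>
    moreover have "y \<notin> C"
    proof
      assume "y \<in> C"
      then obtain w1 G v1 u1 where c: "y = cell w1 G v1 u1" "w1 \<in> W0" "G \<in> \<G>" "v1 \<in> A - {role w1}" "u1 \<in> A"
        unfolding C_def by blast
      then have e: "q = shift w1 G v1" "w(i := B f v u') = wd w1 G v1 u1"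
        using u' by (auto simp: cell_def)
      have "i = pos w1 G"
        using wd_active_iff[of w1 v1 u1 i G] c i(1) B_Act[OF i(2,3) u'(1)] e(2) by (metis DiffD1 fun_upd_same)
      moreover from this have "B f v u' = B (bk w1 G) v1 u1"
        using e(2) unfolding wd_def by (metis fun_upd_same)
      then have "f = bk w1 G" "v = v1"
        using B_inj[OF i(2) bk_F[OF c(2)] i(3) u'(1) _ c(5)] c(4) by blast+
      moreover have "w = (wd w1 G v1 u1)(i := B f v u)"
        using wi unfolding e(2)[symmetric] by simp
      ultimately have "w = wd w1 G v1 u" by (simp add: wd_def)
      then have "(q, w) = cell w1 G v1 u" using e(1) by (simp add: cell_def)
      then show False using qw(4) c i(4) unfolding C_def by blast
    qed
    ultimately show "y \<in> Q \<times> (W - W0) - C" using u' qw(2) by blast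
  qed
  show "row y = row x" if "y \<in> row x" for y
    using that row rx by auto
qed

text \<open>Rows tile the words with an active letter outside \<open>C\<close>; columns tile
  \<open>C\<close> together with the leftover points.\<close>

lemma tile_words: "tile (Q \<times> Pi\<^sub>E {..<N} (\<lambda>_. S))"
proof -
  have "C \<subseteq> Q \<times> (W - W0)"
  proof
    fix c assume "c \<in> C"
    then obtain w G v u where c: "c = cell w G v u" "w \<in> W0" "G \<in> \<G>" "v \<in> A" "u \<in> A"
      unfolding C_def by blast
    have "shift w G v \<in> Q" using hl1[OF c(3)] hl2[OF c(3)] by (auto simp: shift_def)
    moreover have "wd w G v u \<in> W - W0"
      using wd_W[OF c(2,4,5)] wd_active_iff[OF c(2,4,5) pos_less[of w G]] pos_less[of w G] by (auto simp: W0_def)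
    ultimately show "c \<in> Q \<times> (W - W0)" using c(1) by (simp add: cell_def)
  qed
  moreover have "W0 \<subseteq> W" by (auto simp: W0_def)
  ultimately have "Q \<times> W = (Q \<times> (W - W0) - C) \<union> (C \<union> Q \<times> W0)"
    "(Q \<times> (W - W0) - C) \<inter> (C \<union> Q \<times> W0) = {}"
    by blast+
  then show ?thesis
    using tile_Un[OF tile_rows tile_columns] by (simp add: W_def)
qed

end

section \<open>Blocks from monochromatic cliques\<close>

text \<open>Ramsey's theorem for graphs, with \<open>b\<close> as one of two colour classes. The
  letters will be such edge sets \<open>b\<close>.\<close>

lemma ex_clique_in_or_outside:
  obtains R :: nat where "R \<ge> M" "\<And>b. \<exists>H\<in>nsets {..<R} k. nsets H 2 \<subseteq> b \<or> nsets H 2 \<inter> b = {}"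
proof -
  obtain R0 :: nat where R0: "partn_lst {..<R0} [k, k] 2" using ramsey2_full by blast
  define R where "R = max R0 M"
  have R: "partn_lst {..<R} [k, k] 2" "R \<ge> M"
    using partn_lst_greater_resource[OF R0] by (auto simp: R_def)
  have "\<exists>H\<in>nsets {..<R} k. nsets H 2 \<subseteq> b \<or> nsets H 2 \<inter> b = {}" for b
  proof -
    have "(\<lambda>e. if e \<in> b then 0 else 1::nat) \<in> nsets {..<R} 2 \<rightarrow> {..<2}" by auto
    then obtain i H where "i < length [k, k]" "H \<in> nsets {..<R} ([k, k] ! i)"
      "(\<lambda>e. if e \<in> b then 0 else 1::nat) ` nsets H 2 \<subseteq> {i}"
      using partn_lstE[OF R(1), of "\<lambda>e. if e \<in> b then 0 else 1" 2] by (metis length_Cons list.size(3) numeral_2_eq_2)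
    then show ?thesis
      by (intro bexI[of _ H]) (auto simp: image_subset_iff less_Suc_eq nth_Cons' split: if_splits)
  qed
  then show thesis using that R(2) by blast
qed

definition star :: "nat set \<Rightarrow> nat set set" where
  "star H = {{Min H, x} | x. x \<in> H - {Min H}}"

text \<open>A set of edges between the star and the clique on \<open>H\<close> determines \<open>H\<close>; this keeps blocks of different cliques apart.\<close>

lemma Union_between_star_clique:
  assumes "H \<in> nsets UNIV k" "k \<ge> 2" "star H \<subseteq> X" "X \<subseteq> nsets H 2"
  shows "\<Union>X = H"
proof
  show "\<Union>X \<subseteq> H" using assms(4) by (auto simp: nsets_def)
  have H: "finite H" "card H \<ge> 2" using assms(1,2) by (auto simp: nsets_def)
  then have "H \<noteq> {}" by auto
  then have "Min H \<in> H" using H by simp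
  moreover have "H - {Min H} \<noteq> {}"
  proof -
    have "card (H - {Min H}) \<noteq> 0" using H \<open>Min H \<in> H\<close> by simp
    then show ?thesis by (metis card.empty)
  qed
  ultimately show "H \<subseteq> \<Union>X" using assms(3) by (auto simp: star_def)
qed

lemma star_subset: "H \<in> nsets UNIV k \<Longrightarrow> k \<ge> 1 \<Longrightarrow> star H \<subseteq> nsets H 2"
proof -
  assume "H \<in> nsets UNIV k" "k \<ge> 1"
  then have "finite H" "H \<noteq> {}" by (auto simp: nsets_def)
  then have "Min H \<in> H" by simp
  then show ?thesis by (auto simp: star_def)
qed

text \<open>The edges from a second vertex \<open>a\<close> to the \<open>k - 2\<close> remaining
  ones avoid the star.\<close>

lemma card_clique_minus_star:
  assumes "H \<in> nsets UNIV k" "k \<ge> 3"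
  shows "k - 2 \<le> card (nsets H 2 - star H)"
proof -
  have H: "finite H" "card H = k" using assms(1) by (auto simp: nsets_def)
  then have "H \<noteq> {}" using assms(2) by auto
  then have m: "Min H \<in> H" using H by simp
  let ?H = "H - {Min H}"
  have c: "card ?H = k - 1" using H m by simp
  then have "card ?H \<noteq> 0" using assms(2) by simp
  then have "?H \<noteq> {}" by (metis card.empty)
  then obtain a where a: "a \<in> ?H" by blast
  have "(\<lambda>x. {a, x}) ` (?H - {a}) \<subseteq> nsets H 2 - star H"
    using a by (auto simp: star_def doubleton_eq_iff)
  moreover have "inj_on (\<lambda>x. {a, x}) (?H - {a})" by (auto simp: inj_on_def doubleton_eq_iff)
  moreover have "card (?H - {a}) = k - 2" using a H c by simp
  moreover have "finite (nsets H 2 - star H)" using H(1) by (simp add: finite_imp_finite_nsets)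
  ultimately show ?thesis by (metis card_image card_mono)
qed

context finite_poset
begin

definition edge where
  "edge = (SOME f. \<forall>H\<in>nsets (UNIV::nat set) (card A ^ 2 + 3). inj_on (f H) (A \<times> A) \<and>
    f H ` (A \<times> A) \<subseteq> nsets H 2 - star H)"

lemma edge:
  assumes "H \<in> nsets UNIV (card A ^ 2 + 3)"
  shows "inj_on (edge H) (A \<times> A)" "edge H ` (A \<times> A) \<subseteq> nsets H 2 - star H"
proof -
  have "\<exists>g. inj_on g (A \<times> A) \<and> g ` (A \<times> A) \<subseteq> nsets H 2 - star H"
    if "H \<in> nsets UNIV (card A ^ 2 + 3)" for H :: "nat set"
  proof -
    have "card (A \<times> A) \<le> card (nsets H 2 - star H)"
      using card_clique_minus_star[OF that] by (simp add: card_cartesian_product power2_eq_square)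
    moreover have "finite (nsets H 2 - star H)"
      using that by (auto simp: nsets_def[of UNIV] finite_imp_finite_nsets)
    ultimately show ?thesis
      using card_le_inj[of "A \<times> A" "nsets H 2 - star H"] fin by auto
  qed
  then have "\<exists>f. \<forall>H\<in>nsets (UNIV::nat set) (card A ^ 2 + 3). inj_on (f H) (A \<times> A) \<and>
    f H ` (A \<times> A) \<subseteq> nsets H 2 - star H"
    by metis
  from someI_ex[OF this] assms
  show "inj_on (edge H) (A \<times> A)" "edge H ` (A \<times> A) \<subseteq> nsets H 2 - star H"
    unfolding edge_def[symmetric] by auto
qed

text \<open>Encodes a point of the product order by its down-set, with pairs labelled by clique
  edges off the star.\<close>

definition low :: "nat set \<Rightarrow> 'a \<Rightarrow> 'a \<Rightarrow> nat set set" where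
  "low H v u = star H \<union> edge H ` {(v', u'). v' \<in> A \<and> u' \<in> A \<and> (v', v) \<in> r \<and> (u', u) \<in> r}"

text \<open>Encodes the complement of the down-set, which reverses the order; removing it from all
  edges in \<open>block\<close> restores the order.\<close>

definition high :: "nat set \<Rightarrow> 'a \<Rightarrow> 'a \<Rightarrow> nat set set" where
  "high H v u = star H \<union> edge H ` {(v', u'). v' \<in> A \<and> u' \<in> A \<and> \<not> ((v', v) \<in> r \<and> (u', u) \<in> r)}"

text \<open>The flag \<open>True\<close> gives blocks above the letters that miss the clique on
  \<open>H\<close>, \<open>False\<close> blocks below the letters that contain it.\<close>

definition block :: "nat \<Rightarrow> nat set \<times> bool \<Rightarrow> 'a \<Rightarrow> 'a \<Rightarrow> nat set set" where
  "block R = (\<lambda>(H, c) v u. if c then nsets {..<R} 2 - high H v u else low H v u)"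

lemma image_star_le_iff:
  assumes H: "H \<in> nsets UNIV (card A ^ 2 + 3)" and "X \<subseteq> A \<times> A" "Y \<subseteq> A \<times> A"
  shows "star H \<union> edge H ` X \<subseteq> star H \<union> edge H ` Y \<longleftrightarrow> X \<subseteq> Y"
proof
  assume l: "star H \<union> edge H ` X \<subseteq> star H \<union> edge H ` Y"
  show "X \<subseteq> Y"
  proof
    fix x assume x: "x \<in> X"
    then have "edge H x \<in> edge H ` Y" using l edge(2)[OF H] assms(2) by blast
    then obtain y where "y \<in> Y" "edge H x = edge H y" by blast
    then show "x \<in> Y" using inj_onD[OF edge(1)[OF H], of x y] x assms(2,3) by blast
  qed
qed blast

lemma down_pairs_iff:
  assumes "v \<in> A" "u \<in> A" "v' \<in> A" "u' \<in> A"
  shows "{(x, y). x \<in> A \<and> y \<in> A \<and> (x, v) \<in> r \<and> (y, u) \<in> r} \<subseteq> {(x, y). x \<in> A \<and> y \<in> A \<and> (x, v') \<in> r \<and> (y, u') \<in> r}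
    \<longleftrightarrow> (v, v') \<in> r \<and> (u, u') \<in> r"
  using assms r_refl r_trans by blast

lemma low_high_subset:
  assumes H: "H \<in> nsets UNIV (card A ^ 2 + 3)"
  shows "star H \<subseteq> low H v u" "low H v u \<subseteq> nsets H 2" "star H \<subseteq> high H v u" "high H v u \<subseteq> nsets H 2"
  using edge(2)[OF H] star_subset[OF H] by (auto simp: low_def high_def)

lemma block_le_iff:
  assumes H: "H \<in> nsets {..<R} (card A ^ 2 + 3)" and A: "v \<in> A" "u \<in> A" "v' \<in> A" "u' \<in> A"
  shows "block R (H, c) v u \<subseteq> block R (H, c) v' u' \<longleftrightarrow> (v, v') \<in> r \<and> (u, u') \<in> r"
proof -
  have H': "H \<in> nsets UNIV (card A ^ 2 + 3)" using H by (auto simp: nsets_def)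
  have "nsets H 2 \<subseteq> nsets {..<R} 2" using H by (intro nsets_mono) (auto simp: nsets_def)
  then have "high H v u \<subseteq> nsets {..<R} 2" for v u using low_high_subset(4)[OF H'] by blast
  then have "block R (H, True) v u \<subseteq> block R (H, True) v' u' \<longleftrightarrow> high H v' u' \<subseteq> high H v u"
    by (auto simp: block_def)
  also have "\<dots> \<longleftrightarrow> {(x, y). x \<in> A \<and> y \<in> A \<and> \<not> ((x, v') \<in> r \<and> (y, u') \<in> r)}
      \<subseteq> {(x, y). x \<in> A \<and> y \<in> A \<and> \<not> ((x, v) \<in> r \<and> (y, u) \<in> r)}"
    unfolding high_def by (rule image_star_le_iff[OF H']) auto
  also have "\<dots> \<longleftrightarrow> (v, v') \<in> r \<and> (u, u') \<in> r"
    unfolding down_pairs_iff[OF A, symmetric] by blast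
  finally have 1: "block R (H, True) v u \<subseteq> block R (H, True) v' u' \<longleftrightarrow> (v, v') \<in> r \<and> (u, u') \<in> r" .
  have "low H v u \<subseteq> low H v' u' \<longleftrightarrow> (v, v') \<in> r \<and> (u, u') \<in> r"
    unfolding low_def down_pairs_iff[OF A, symmetric] by (rule image_star_le_iff[OF H']) auto
  then show ?thesis using 1 by (cases c) (auto simp: block_def)
qed

text \<open>For equal flags \<open>H\<close> is the union of the edges present or removed. For
  different flags an edge outside both cliques lies in the \<open>True\<close> block only.\<close>

lemma block_eq:
  assumes H: "H \<in> nsets {..<R} (card A ^ 2 + 3)" "H' \<in> nsets {..<R} (card A ^ 2 + 3)"
    and R: "R \<ge> 2 * card A ^ 2 + 8" and eq: "block R (H, c) v u = block R (H', c') v' u'"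
  shows "(H, c) = (H', c')"
proof -
  let ?k = "card A ^ 2 + 3" and ?E = "nsets {..<R} (2::nat)"
  have H': "H \<in> nsets UNIV ?k" "H' \<in> nsets UNIV ?k" using H by (auto simp: nsets_def)
  have sub: "nsets H 2 \<subseteq> ?E" "nsets H' 2 \<subseteq> ?E" using H by (auto intro!: nsets_mono simp: nsets_def)
  have Un: "\<Union>(low H v u) = H" "\<Union>(low H' v' u') = H'" "\<Union>(high H v u) = H" "\<Union>(high H' v' u') = H'"
    using Union_between_star_clique low_high_subset H' by (auto simp del: Union_iff)
  have no: "low K x y \<noteq> ?E - high K' x' y'"
    if K: "K \<in> nsets {..<R} ?k" "K' \<in> nsets {..<R} ?k" for K K' x y x' y'
  proof
    assume e: "low K x y = ?E - high K' x' y'"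
    have K': "K \<in> nsets UNIV ?k" "K' \<in> nsets UNIV ?k" using K by (auto simp: nsets_def)
    have f: "finite (K \<union> K')" "card (K \<union> K') \<le> 2 * ?k"
      using K card_Un_le[of K K'] by (auto simp: nsets_def)
    have "card ({..<R} - (K \<union> K')) \<ge> R - 2 * ?k"
      using f diff_card_le_card_Diff[of "K \<union> K'" "{..<R}"] by simp
    \<comment> \<open>Two cliques cover at most \<open>2 * card A ^ 2 + 6\<close> vertices, so the
      bound on \<open>R\<close> leaves two for an edge.\<close>
    then have "card ({..<R} - (K \<union> K')) \<ge> 2" using R by simp
    then obtain T where T: "T \<subseteq> {..<R} - (K \<union> K')" "card T = 2" by (meson obtain_subset_with_card_n)
    then have "T \<in> ?E" by (auto simp: nsets_def intro: card_ge_0_finite)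
    moreover have "T \<noteq> {}" using T(2) by auto
    then have "\<not> T \<subseteq> K" "\<not> T \<subseteq> K'" using T(1) by auto
    then have "T \<notin> low K x y" "T \<notin> high K' x' y'"
      using low_high_subset(2)[OF K'(1), of x y] low_high_subset(4)[OF K'(2), of x' y'] by (auto simp: nsets_def)
    ultimately show False using e by blast
  qed
  show ?thesis
  proof (cases "c = c'")
    case True
    have "H = H'"
    proof (cases c)
      case True
      then have "?E - high H v u = ?E - high H' v' u'" using eq \<open>c = c'\<close> by (simp add: block_def)
      moreover have "high H v u \<subseteq> ?E" "high H' v' u' \<subseteq> ?E" using low_high_subset(4) H' sub by blast+
      ultimately have "high H v u = high H' v' u'" by blast
      then show ?thesis using Un by metis
    next
      case False
      then show ?thesis using eq Un \<open>c = c'\<close> by (simp add: block_def)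
    qed
    then show ?thesis using True by simp
  next
    case False
    then show ?thesis using eq no[OF H, of v u v' u'] no[OF H(2,1), of v' u' v u] by (cases c) (auto simp: block_def)
  qed
qed

end

section \<open>Sets cut by a fixed set\<close>

text \<open>The product of the punctured cube over \<open>B\<close> with the cube over \<open>K\<close>.\<close>

definition Reg :: "'b set \<Rightarrow> 'b set \<Rightarrow> 'b set set" where
  "Reg B K = {X. X \<subseteq> B \<union> K \<and> X \<inter> B \<noteq> {} \<and> \<not> B \<subseteq> X}"

lemma Reg_image:
  assumes "inj_on h (B \<union> K)"
  shows "Reg (h ` B) (h ` K) = (`) h ` Reg B K"
proof -
  have iff: "h x \<in> h ` X \<longleftrightarrow> x \<in> X" if "X \<subseteq> B \<union> K" "x \<in> B \<union> K" for x X
    using assms that by (auto dest: inj_onD)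
  show ?thesis
  proof (intro equalityI subsetI)
    fix Y assume Y: "Y \<in> Reg (h ` B) (h ` K)"
    define X where "X = {x \<in> B \<union> K. h x \<in> Y}"
    have "Y = h ` X" using Y by (auto simp: X_def Reg_def)
    moreover have "X \<in> Reg B K" using Y by (auto simp: X_def Reg_def)
    ultimately show "Y \<in> (`) h ` Reg B K" by blast
  next
    fix Y assume "Y \<in> (`) h ` Reg B K"
    then obtain X where X: "Y = h ` X" "X \<subseteq> B \<union> K" "X \<inter> B \<noteq> {}" "\<not> B \<subseteq> X" by (auto simp: Reg_def)
    then obtain b where b: "b \<in> B" "b \<notin> X" by blast
    then have "h b \<notin> Y" using iff[OF X(2)] X(1) by blast
    then show "Y \<in> Reg (h ` B) (h ` K)" using X(1,2,3) b(1) by (auto simp: Reg_def)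
  qed
qed

context finite_poset
begin

lemma tile_Reg_image:
  assumes "tile (Reg B K)" "inj_on h (B \<union> K)"
  shows "tile (Reg (h ` B) (h ` K))"
  unfolding Reg_image[OF assms(2)]
proof (rule tile_image[OF assms(1)])
  fix X Y assume "X \<in> Reg B K" "Y \<in> Reg B K"
  then have "X \<subseteq> B \<union> K" "Y \<subseteq> B \<union> K" by (auto simp: Reg_def)
  then show "X \<le> Y \<longleftrightarrow> h ` X \<le> h ` Y" using assms(2) unfolding inj_on_def by blast
qed

lemma tile_Reg_card:
  assumes "tile (Reg B K)" "finite B" "finite K" "B \<inter> K = {}"
    and "finite B'" "finite K'" "B' \<inter> K' = {}" "card B' = card B" "card K' = card K"
  shows "tile (Reg B' K')"
proof -
  obtain f where f: "bij_betw f B B'" using assms by (metis finite_same_card_bij)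
  obtain g where g: "bij_betw g K K'" using assms by (metis finite_same_card_bij)
  define h where "h = (\<lambda>x. if x \<in> B then f x else g x)"
  have "bij_betw h B B'" using f by (rule bij_betw_cong[THEN iffD1, rotated]) (simp add: h_def)
  moreover have "bij_betw h K K'"
    using g by (rule bij_betw_cong[THEN iffD1, rotated]) (use assms(4) in \<open>auto simp: h_def\<close>)
  ultimately have h: "bij_betw h B B'" "bij_betw h K K'" .
  then have "bij_betw h (B \<union> K) (B' \<union> K')" using assms(7) by (rule bij_betw_combine)
  then show ?thesis
    using tile_Reg_image[OF assms(1), of h] h by (simp add: bij_betw_def)
qed

text \<open>One shifted tiling for every \<open>Y\<close>; the trace on \<open>L\<close> keeps them
  apart.\<close>

lemma tile_spread:
  assumes "tile Z" "Z \<subseteq> Pow M" "M \<inter> L = {}"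
  shows "tile {X \<union> Y | X Y. X \<in> Z \<and> Y \<subseteq> L}"
proof -
  have "tile (\<Union>Y\<in>Pow L. (\<lambda>X. X \<union> Y) ` Z)"
  proof (rule tile_UN)
    fix Y assume Y: "Y \<in> Pow L"
    show "tile ((\<lambda>X. X \<union> Y) ` Z)"
    proof (rule tile_image[OF assms(1)])
      fix X X' assume "X \<in> Z" "X' \<in> Z"
      then have "X \<inter> Y = {}" "X' \<inter> Y = {}" using Y assms(2,3) by blast+
      then show "X \<le> X' \<longleftrightarrow> X \<union> Y \<le> X' \<union> Y" by blast
    qed
  next
    have "(X \<union> Y) \<inter> L = Y" if "X \<in> Z" "Y \<subseteq> L" for X Y
      using that assms(2,3) by blast
    then show "disjoint_family_on (\<lambda>Y. (\<lambda>X. X \<union> Y) ` Z) (Pow L)"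
      unfolding disjoint_family_on_def by (auto simp: disjoint_iff) (metis subsetD)+
  qed
  also have "(\<Union>Y\<in>Pow L. (\<lambda>X. X \<union> Y) ` Z) = {X \<union> Y | X Y. X \<in> Z \<and> Y \<subseteq> L}"
    by blast
  finally show ?thesis .
qed

lemma Reg_extend:
  assumes "L \<inter> (B \<union> K) = {}"
  shows "Reg B (K \<union> L) = {X \<union> Y | X Y. X \<in> Reg B K \<and> Y \<subseteq> L}"
proof (intro equalityI subsetI)
  fix X assume "X \<in> Reg B (K \<union> L)"
  then have "X - L \<in> Reg B K" "X = (X - L) \<union> (X \<inter> L)" using assms by (auto simp: Reg_def)
  then show "X \<in> {X \<union> Y | X Y. X \<in> Reg B K \<and> Y \<subseteq> L}" by blast
qed (use assms in \<open>auto simp: Reg_def\<close>)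

lemma tile_Reg_extend:
  assumes "tile (Reg B K)" "L \<inter> (B \<union> K) = {}"
  shows "tile (Reg B (K \<union> L))"
  unfolding Reg_extend[OF assms(2)]
  by (rule tile_spread[OF assms(1), of "B \<union> K"]) (use assms(2) in \<open>auto simp: Reg_def\<close>)

text \<open>A word over \<open>Pow E\<close> is a subset of \<open>{..<N} \<times> E\<close>, so the
  product is a punctured cube times a cube. The empty summands bring both ground sets into one sum
  type.\<close>

lemma tile_Reg_words:
  fixes N :: nat
  assumes "tile ((Pow U - {{}, U}) \<times> Pow L \<times> Pi\<^sub>E {..<N} (\<lambda>_. Pow E))"
  shows "tile (Reg (U <+> {}) ({} <+> (L <+> {..<N} \<times> E)))"
proof -
  let ?T = "(Pow U - {{}, U}) \<times> Pow L \<times> Pi\<^sub>E {..<N} (\<lambda>_. Pow E)"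
  define g where "g = (\<lambda>(d :: 'b set, l :: 'c set, w :: nat \<Rightarrow> 'd set). d <+> (l <+> Sigma {..<N} w))"
  have sub: "P <+> P' \<subseteq> R <+> R' \<longleftrightarrow> P \<subseteq> R \<and> P' \<subseteq> R'" for P R :: "'x set" and P' R' :: "'y set"
    by auto
  have "tile (g ` ?T)"
  proof (rule tile_image[OF assms])
    fix x y assume "x \<in> ?T" "y \<in> ?T"
    moreover obtain d l w d' l' w' where xy: "x = (d, l, w)" "y = (d', l', w')" by (metis prod_cases3)
    ultimately have w: "w \<in> Pi\<^sub>E {..<N} (\<lambda>_. Pow E)" "w' \<in> Pi\<^sub>E {..<N} (\<lambda>_. Pow E)" by auto
    have "w i \<le> w' i" if "Sigma {..<N} w \<subseteq> Sigma {..<N} w'" for i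
    proof (cases "i < N")
      case True
      then show ?thesis using that by blast
    next
      case False
      then show ?thesis using PiE_arb[OF w(1)] PiE_arb[OF w(2)] by simp
    qed
    then have "w \<le> w' \<longleftrightarrow> Sigma {..<N} w \<subseteq> Sigma {..<N} w'"
      unfolding le_fun_def by blast
    then show "x \<le> y \<longleftrightarrow> g x \<le> g y" by (simp add: xy g_def sub)
  qed
  also have "g ` ?T = Reg (U <+> {}) ({} <+> (L <+> {..<N} \<times> E))"
  proof (intro equalityI subsetI)
    fix X assume "X \<in> g ` ?T"
    then obtain d l w where X: "X = d <+> (l <+> Sigma {..<N} w)" "d \<subseteq> U" "d \<noteq> {}" "d \<noteq> U" "l \<subseteq> L"
      "w \<in> Pi\<^sub>E {..<N} (\<lambda>_. Pow E)"
      by (auto simp: g_def)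
    have "Sigma {..<N} w \<subseteq> {..<N} \<times> E" using X(6) by auto
    then show "X \<in> Reg (U <+> {}) ({} <+> (L <+> {..<N} \<times> E))"
      using X(2-5) unfolding Reg_def X(1) by auto
  next
    fix X assume X: "X \<in> Reg (U <+> {}) ({} <+> (L <+> {..<N} \<times> E))"
    define d where "d = {x. Inl x \<in> X}"
    define l where "l = {x. Inr (Inl x) \<in> X}"
    define w where "w = (\<lambda>i\<in>{..<N}. {e. Inr (Inr (i, e)) \<in> X})"
    have "X = g (d, l, w)"
      using X by (auto simp: g_def d_def l_def w_def Reg_def)
    moreover have "(d, l, w) \<in> ?T"
      using X by (auto simp: d_def l_def w_def Reg_def)
    ultimately show "X \<in> g ` ?T" by blast
  qed
  finally show ?thesis .
qed

text \<open>The absorption argument with edge sets on \<open>R\<close> vertices as letters and a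
  punctured cube times a cube as \<open>Q\<close>.\<close>

lemma ex_tile_words:
  "\<exists>(m::nat) (l::nat) (N::nat). \<exists>E :: nat set set. m \<ge> 3 \<and> finite E \<and>
    tile ((Pow {..<m} - {{}, {..<m}}) \<times> Pow {..<l} \<times> Pi\<^sub>E {..<N} (\<lambda>_. Pow E))"
proof -
  let ?p = "card A"
  obtain m l0 where m: "m \<ge> 3" and dvd: "\<And>l. l \<ge> l0 \<Longrightarrow> ?p dvd (2 ^ m - 2) * 2 ^ l"
    using ex_dvd_punctured_cube[OF card_pos] by blast
  \<comment> \<open>Large enough both for divisibility and, since \<open>l < 2 ^ l\<close>, for the
    size of the fibres.\<close>
  define l where "l = l0 + ?p * 2 ^ m"
  have "?p * 2 ^ m \<le> l" by (simp add: l_def)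
  then have "?p * 2 ^ m \<le> 2 ^ l" using less_exp[of l] by linarith
  let ?V = "Pow {..<m} - {{}, {..<m}}"
  let ?Q = "?V \<times> Pow {..<l}"
  obtain \<G> where part: "partition_on ?Q \<G>" and card_G: "\<And>G. G \<in> \<G> \<Longrightarrow> card G = ?p"
    and "\<forall>G\<in>\<G>. \<exists>i<m. \<exists>j<m. i \<noteq> j \<and> (\<forall>x\<in>G. i \<in> fst x \<and> j \<notin> fst x)"
    using partition_punctured_cube[OF m card_pos dvd \<open>?p * 2 ^ m \<le> 2 ^ l\<close>] by (auto simp: l_def)
  then have "\<forall>G\<in>\<G>. \<exists>i j. i < m \<and> j < m \<and> i \<noteq> j \<and> (\<forall>x\<in>G. i \<in> fst x \<and> j \<notin> fst x)" by blast
  then obtain i j where ij: "\<And>G. G \<in> \<G> \<Longrightarrow> i G < m \<and> j G < m \<and> i G \<noteq> j G \<and> (\<forall>x\<in>G. i G \<in> fst x \<and> j G \<notin> fst x)"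
    by metis
  let ?k = "?p ^ 2 + 3"
  obtain R where R: "R \<ge> 2 * ?p ^ 2 + 8"
    and mono: "\<And>b. \<exists>H\<in>nsets {..<R} ?k. nsets H 2 \<subseteq> b \<or> nsets H 2 \<inter> b = {}"
    using ex_clique_in_or_outside by metis
  let ?E = "nsets {..<R} (2::nat)"
  let ?F = "nsets {..<R} ?k \<times> (UNIV :: bool set)"
  from mono obtain H where H: "\<And>b. H b \<in> nsets {..<R} ?k \<and> (nsets (H b) 2 \<subseteq> b \<or> nsets (H b) 2 \<inter> b = {})"
    by metis
  have HU: "K \<in> nsets UNIV ?k" "nsets K 2 \<subseteq> ?E" if "K \<in> nsets {..<R} ?k" for K
    using that by (auto simp: nsets_def)
  define blk where "blk = (\<lambda>b. (H b, nsets (H b) 2 \<inter> b = {}))"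
  define Act where "Act = {block R f v u | f v u. f \<in> ?F \<and> v \<in> A \<and> u \<in> A}"
  have fin_Q: "finite ?Q" by simp
  have fin_G: "finite \<G>" using part fin_Q by (rule finite_elements[rotated])
  \<comment> \<open>A third coordinate keeps \<open>{i G, j G}\<close> and its complement inside the
    punctured cube.\<close>
  have third: "\<exists>a<m. a \<noteq> x \<and> a \<noteq> y" for x y
  proof -
    have "card {x, y} < card {..<m}" using m card_insert_le_m1[of 2 "{y}" x] by (simp add: card_insert_if)
    then have "\<not> {..<m} \<subseteq> {x, y}" by (metis card_mono finite.emptyI finite.insertI not_le)
    then show ?thesis by blast
  qed
  have V: "{..<m} - {j G} \<in> ?V" "{..<m} - {i G, j G} \<in> ?V" "{i G} \<in> ?V" "{i G, j G} \<in> ?V" if "G \<in> \<G>" for G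
    using ij[OF that] third[of "i G" "j G"] by auto
  \<comment> \<open>All members of \<open>G\<close> contain \<open>i G\<close> and miss
    \<open>j G\<close>. The upper pair is the largest point missing \<open>j G\<close>, with and
    without \<open>i G\<close>; the lower pair is the least point containing \<open>i G\<close>,
    with and without \<open>j G\<close>. The summand 1 makes \<open>N\<close> positive.\<close>
  interpret absorption A r ?Q "Pow ?E" ?F "block R" snd blk Act \<G>
    "\<lambda>G. ({..<m} - {j G}, {..<l})" "\<lambda>G. ({..<m} - {i G, j G}, {..<l})"
    "\<lambda>G. ({i G, j G}, {})" "\<lambda>G. ({i G}, {})" "2 * card (Pow ?E) * card \<G> + 1"
  proof
    show "Act = {block R f v u | f v u. f \<in> ?F \<and> v \<in> A \<and> u \<in> A}" by (fact Act_def)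
    show "finite (Pow ?E)" by (simp add: finite_imp_finite_nsets)
    show "block R f v u \<le> block R f v' u' \<longleftrightarrow> (v, v') \<in> r \<and> (u, u') \<in> r"
      if "f \<in> ?F" "v \<in> A" "u \<in> A" "v' \<in> A" "u' \<in> A" for f v u v' u'
      using block_le_iff that by (cases f) auto
    show "f = g" if "f \<in> ?F" "g \<in> ?F" "block R f v u = block R g v' u'" for f g v u v' u'
      using block_eq[OF _ _ R] that by (cases f; cases g) blast
    show "Act \<subseteq> Pow ?E"
      using low_high_subset(2)[OF HU(1)] HU(2) unfolding Act_def
      by (auto simp: block_def split: if_splits) blast
    show "blk b \<in> ?F" for b using H by (simp add: blk_def)
    show "b \<le> block R (blk b) v u" if "b \<in> Pow ?E" "snd (blk b)" for b v u
      using that low_high_subset(4)[OF HU(1), of "H b" v u] H[of b] by (auto simp: blk_def block_def)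
    show "block R (blk b) v u \<le> b" if "b \<in> Pow ?E" "\<not> snd (blk b)" for b v u
      using that low_high_subset(2)[OF HU(1), of "H b" v u] H[of b] by (auto simp: blk_def block_def)
    show "partition_on ?Q \<G>" "finite \<G>" by fact+
    show "card G = card A" if "G \<in> \<G>" for G using card_G that .
    fix G assume G: "G \<in> \<G>"
    have "G \<subseteq> ?Q" using partition_onD1[OF part] G by blast
    then have GQ: "fst d \<subseteq> {..<m}" "snd d \<subseteq> {..<l}" if "d \<in> G" for d
      using subsetD[OF _ that, of ?Q] by (simp_all add: mem_Times_iff)
    show "({..<m} - {j G}, {..<l}) \<in> ?Q \<and> ({..<m} - {i G, j G}, {..<l}) \<in> ?Q \<and>
      ({..<m} - {i G, j G}, {..<l}) \<le> ({..<m} - {j G}, {..<l}) \<and>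
      (\<forall>d\<in>G. d \<le> ({..<m} - {j G}, {..<l}) \<and> \<not> d \<le> ({..<m} - {i G, j G}, {..<l}))"
      using V[OF G] ij[OF G] GQ by (auto simp: less_eq_prod_def)
    show "({i G, j G}, {}) \<in> ?Q \<and> ({i G}, {}) \<in> ?Q \<and> ({i G}, {}) \<le> ({i G, j G}, {}) \<and>
      (\<forall>d\<in>G. ({i G}, {}) \<le> d \<and> \<not> ({i G, j G}, {}) \<le> d)"
      using V[OF G] ij[OF G] by (auto simp: less_eq_prod_def)
  qed auto
  have "tile ((\<lambda>((d, l), w). (d, l, w)) ` (?Q \<times> Pi\<^sub>E {..<2 * card (Pow ?E) * card \<G> + 1} (\<lambda>_. Pow ?E)))"
    by (rule tile_image[OF tile_words]) auto
  also have "(\<lambda>((d, l), w). (d, l, w)) ` (?Q \<times> X) = ?V \<times> Pow {..<l} \<times> X" for X :: "(nat \<Rightarrow> nat set set) set"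
    by (auto simp: image_iff)
  finally have "tile (?V \<times> Pow {..<l} \<times> Pi\<^sub>E {..<2 * card (Pow ?E) * card \<G> + 1} (\<lambda>_. Pow ?E))" .
  moreover have "finite ?E" by (simp add: finite_imp_finite_nsets)
  ultimately show ?thesis using m by (intro exI conjI)
qed

text \<open>Only the sizes matter, and surplus points of \<open>K\<close> are free
  coordinates.\<close>

lemma ex_tile_Reg:
  obtains m k :: nat where "m \<ge> 3"
    "\<And>B K :: nat set. finite B \<Longrightarrow> finite K \<Longrightarrow> B \<inter> K = {} \<Longrightarrow> card B = m \<Longrightarrow> k \<le> card K \<Longrightarrow> tile (Reg B K)"
proof -
  obtain m l N :: nat and E :: "nat set set" where m: "m \<ge> 3" "finite E"
    and T: "tile ((Pow {..<m} - {{}, {..<m}}) \<times> Pow {..<l} \<times> Pi\<^sub>E {..<N} (\<lambda>_. Pow E))"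
    using ex_tile_words by blast
  let ?K = "({} :: nat set) <+> ({..<l} <+> {..<N} \<times> E)"
  have "tile (Reg B K)"
    if BK: "finite B" "finite K" "B \<inter> K = {}" "card B = m" "card ?K \<le> card K" for B K :: "nat set"
  proof -
    obtain K1 where K1: "K1 \<subseteq> K" "card K1 = card ?K" using obtain_subset_with_card_n[OF BK(5)] by metis
    have "tile (Reg B K1)"
    proof (rule tile_Reg_card[OF tile_Reg_words[OF T]])
      show "finite K1" using K1 BK finite_subset by blast
      show "B \<inter> K1 = {}" using K1 BK by blast
      show "card B = card ({..<m} <+> {})" using BK by (simp add: card_Plus)
    qed (use BK K1 m in auto)
    then have "tile (Reg B (K1 \<union> (K - K1)))" using BK K1 by (intro tile_Reg_extend) auto
    also have "K1 \<union> (K - K1) = K" using K1 by blast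
    finally show ?thesis .
  qed
  then show thesis by (rule that[OF m(1)])
qed

text \<open>The sets that avoid or contain \<open>B1\<close> do not distinguish its points, so \<open>B1\<close> may be shrunk to the point \<open>e\<close>.\<close>

lemma tile_Reg_blow_up_step:
  fixes B K :: "'b set"
  assumes B1: "B1 \<subseteq> B" "e \<in> B1" "B \<inter> K = {}" and T: "tile (Reg (insert e (B - B1)) K)"
  shows "tile (Reg B K - Reg B1 (B - B1 \<union> K))"
proof -
  define B' where "B' = insert e (B - B1)"
  have T': "tile (Reg B' K)" using T by (simp add: B'_def)
  \<comment> \<open>Replaces the point \<open>e\<close> by the whole of \<open>B1\<close>.\<close>
  define h where "h = (\<lambda>X. if e \<in> X then X \<union> B1 else X)"
  have sub: "X \<subseteq> B - B1 \<union> K \<union> {e}" if "X \<in> Reg B' K" for X using that by (auto simp: Reg_def B'_def)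
  have K1: "B1 \<inter> K = {}" using B1 by blast
  have e: "e \<in> B1" by fact
  have "tile (h ` Reg B' K)"
  proof (rule tile_image[OF T'])
    fix X Y assume XY: "X \<in> Reg B' K" "Y \<in> Reg B' K"
    show "X \<le> Y \<longleftrightarrow> h X \<le> h Y"
      using sub[OF XY(1)] sub[OF XY(2)] e K1 by (cases "e \<in> X"; cases "e \<in> Y") (auto simp: h_def)
  qed
  also have "h ` Reg B' K = Reg B K - Reg B1 (B - B1 \<union> K)"
  proof (intro equalityI subsetI)
    fix X assume "X \<in> h ` Reg B' K"
    then obtain Y where Y: "X = h Y" "Y \<in> Reg B' K" by blast
    then have "h Y \<inter> B1 = {} \<or> B1 \<subseteq> h Y" using sub[of Y] K1 by (auto simp: h_def)
    then have "X \<notin> Reg B1 (B - B1 \<union> K)" using Y(1) by (auto simp: Reg_def)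
    moreover have "X \<in> Reg B K" using Y B1 e K1 by (auto simp: Reg_def h_def B'_def split: if_splits)
    ultimately show "X \<in> Reg B K - Reg B1 (B - B1 \<union> K)" by blast
  next
    fix X assume X: "X \<in> Reg B K - Reg B1 (B - B1 \<union> K)"
    then have c: "X \<inter> B1 = {} \<or> B1 \<subseteq> X" using B1 by (auto simp: Reg_def)
    define Y where "Y = X - (B1 - {e})"
    have "h Y = X" using c e by (auto simp: Y_def h_def)
    moreover have "Y \<in> Reg B' K"
      using c X e B1 K1 unfolding Reg_def Y_def B'_def by auto
    ultimately show "X \<in> h ` Reg B' K" by blast
  qed
  finally show ?thesis .
qed

text \<open>Induction from a single point, whose region is empty. Each step replaces a point by
  \<open>m\<close> points and so adds \<open>m - 1\<close>.\<close>

lemma tile_Reg_blow_up: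
  fixes m k t :: nat and B K :: "nat set"
  assumes T: "\<And>B K :: nat set. finite B \<Longrightarrow> finite K \<Longrightarrow> B \<inter> K = {} \<Longrightarrow> card B = m \<Longrightarrow> k \<le> card K \<Longrightarrow> tile (Reg B K)"
    and m: "m \<ge> 3"
    and B: "finite B" "finite K" "B \<inter> K = {}" "card B = 1 + t * (m - 1)" "k \<le> card K"
  shows "tile (Reg B K)"
  using B
proof (induction t arbitrary: B)
  case 0
  then obtain b where "B = {b}" by (metis card_1_singletonE add.right_neutral mult_zero_left)
  then have "Reg B K = {}" by (auto simp: Reg_def)
  then show ?case using tile_empty by simp
next
  case (Suc t)
  then have "m \<le> card B" using m by simp
  then obtain B1 where B1: "B1 \<subseteq> B" "card B1 = m" by (meson obtain_subset_with_card_n)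
  then have "B1 \<noteq> {}" using m by auto
  then obtain e where e: "e \<in> B1" by blast
  have finB1: "finite B1" using B1 Suc.prems finite_subset by blast
  have K1: "B1 \<inter> K = {}" using B1 Suc.prems by blast
  have "card (B - B1) = card B - m" using B1 finB1 by (simp add: card_Diff_subset)
  then have "card (insert e (B - B1)) = 1 + t * (m - 1)"
    using e Suc.prems m by (simp add: card_insert_if)
  then have "tile (Reg (insert e (B - B1)) K)"
    using Suc.IH[of "insert e (B - B1)"] Suc.prems B1 e by auto
  then have 1: "tile (Reg B K - Reg B1 (B - B1 \<union> K))"
    using B1 e Suc.prems by (intro tile_Reg_blow_up_step) auto
  \<comment> \<open>The sets that split \<open>B1\<close> form a region over an
    \<open>m\<close>-set, with the rest of \<open>B\<close> as free coordinates.\<close>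
  have 2: "tile (Reg B1 (B - B1 \<union> K))"
  proof (rule T)
    have "card K \<le> card (B - B1 \<union> K)" using Suc.prems by (intro card_mono) auto
    then show "k \<le> card (B - B1 \<union> K)" using Suc.prems by linarith
  qed (use B1 finB1 K1 Suc.prems in auto)
  have "Reg B1 (B - B1 \<union> K) \<subseteq> Reg B K" using B1 by (auto simp: Reg_def)
  then have "Reg B K = (Reg B K - Reg B1 (B - B1 \<union> K)) \<union> Reg B1 (B - B1 \<union> K)" by blast
  then show ?case using tile_Un[OF 1 2] by auto
qed

end

section \<open>The remaining sets\<close>

lemma Un_subset_Un_iff:
  assumes "P \<subseteq> X" "P' \<subseteq> X" "S \<subseteq> Y" "S' \<subseteq> Y" "X \<inter> Y = {}"
  shows "P \<union> S \<subseteq> P' \<union> S' \<longleftrightarrow> P \<subseteq> P' \<and> S \<subseteq> S'"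
  using assms by blast

lemma image_subset_image_iff:
  "inj_on f C \<Longrightarrow> X \<subseteq> C \<Longrightarrow> Y \<subseteq> C \<Longrightarrow> f ` X \<subseteq> f ` Y \<longleftrightarrow> X \<subseteq> Y"
  unfolding inj_on_def by blast

context finite_poset
begin

definition dn :: "'a \<Rightarrow> 'a set" where "dn v = {a \<in> A. (a, v) \<in> r}"

lemma dn_subset_iff: "v \<in> A \<Longrightarrow> v' \<in> A \<Longrightarrow> dn v \<subseteq> dn v' \<longleftrightarrow> (v, v') \<in> r"
  unfolding dn_def using r_refl r_trans by blast

text \<open>The elements satisfying \<open>P\<close> are matched with a down-set of the same
  size.\<close>

lemma ex_bij_down_set:
  assumes "card G = card A"
  shows "\<exists>f. bij_betw f A G \<and> (\<forall>i\<in>A. \<forall>i'\<in>A. (i, i') \<in> r \<longrightarrow> P (f i') \<longrightarrow> P (f i))"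
proof -
  have finG: "finite G" using assms card_pos by (metis card.infinite less_numeral_extra(3))
  define G0 where "G0 = {w \<in> G. P w}"
  have "card G0 \<le> card A" unfolding G0_def assms[symmetric] by (intro card_mono finG) auto
  then obtain D where D: "D \<subseteq> A" "card D = card G0" "\<forall>x\<in>A. \<forall>y\<in>D. (x, y) \<in> r \<longrightarrow> x \<in> D"
    using ex_down_set by blast
  have fin': "finite D" "finite G0" using D(1) fin finG finite_subset by (auto simp: G0_def)
  obtain f where f: "bij_betw f D G0" using D(2) fin' by (metis finite_same_card_bij)
  have "card (A - D) = card (G - G0)"
    using D fin' assms by (simp add: card_Diff_subset G0_def)
  then obtain g where g: "bij_betw g (A - D) (G - G0)"
    using fin finG by (metis finite_Diff finite_same_card_bij)
  define h where "h = (\<lambda>x. if x \<in> D then f x else g x)"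
  have "bij_betw h D G0" using f by (rule bij_betw_cong[THEN iffD1, rotated]) (simp add: h_def)
  moreover have "bij_betw h (A - D) (G - G0)"
    using g by (rule bij_betw_cong[THEN iffD1, rotated]) (simp add: h_def)
  ultimately have "bij_betw h (D \<union> (A - D)) (G0 \<union> (G - G0))" by (rule bij_betw_combine) blast
  moreover have "D \<union> (A - D) = A" "G0 \<union> (G - G0) = G" using D(1) by (auto simp: G0_def)
  ultimately have h: "bij_betw h A G" by simp
  have P: "P (h i) \<longleftrightarrow> i \<in> D" if "i \<in> A" for i
    using that bij_betwE[OF f] bij_betwE[OF g] by (auto simp: h_def G0_def)
  show ?thesis using h P D(3) by blast
qed

text \<open>
  The tiles \<open>f0 ` A\<close> over the points \<open>\<eta> G i v\<close> form, for fixed \<open>G\<close> and \<open>i\<close>, a copy of \<open>P \<times> P\<close>. Tiling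
  it by columns, one column takes in the remaining set \<open>\<omega> G i\<close> and gives up \<open>swap G i\<close>; for fixed \<open>G\<close>
  the sets given up form a copy of \<open>P\<close>. Remaining sets avoiding \<open>M\<close> become minimal elements,
  the others maximal ones, so the former have to be indexed by a down-set of \<open>P\<close>.
\<close>

lemma tile_absorb_rest:
  fixes f0 :: "'a \<Rightarrow> 'b set"
  assumes f0: "emb f0" "\<And>t. t \<in> A \<Longrightarrow> f0 t \<subseteq> M \<and> f0 t \<noteq> {} \<and> f0 t \<noteq> M"
    and fin': "finite M" "finite T" "finite K" and disj: "M \<inter> T = {}" "M \<inter> K = {}" "T \<inter> K = {}"
    and T: "2 * 2 ^ card K + 2 * card A \<le> card T"
  defines "E0 \<equiv> {X. X \<subseteq> M \<union> T \<union> K \<and> (X \<inter> (M \<union> T) = {} \<or> M \<union> T \<subseteq> X)} - {{}, M \<union> T \<union> K}"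
  shows "\<exists>E1\<subseteq>E0. card (E0 - E1) \<le> card A - 1 \<and>
    tile ({X \<union> Y | X Y. X \<in> f0 ` A \<and> Y \<subseteq> T \<union> K} \<union> E1)"
proof -
  let ?p = "card A"
  \<comment> \<open>A remaining set is determined by its trace on \<open>K\<close> and one bit,
    which bounds their number independently of \<open>T\<close>.\<close>
  have E0_sub: "E0 \<subseteq> (\<lambda>(c, Y). if c then M \<union> T \<union> Y else Y) ` (UNIV \<times> Pow K)"
  proof
    fix X assume X: "X \<in> E0"
    show "X \<in> (\<lambda>(c, Y). if c then M \<union> T \<union> Y else Y) ` (UNIV \<times> Pow K)"
    proof (cases "X \<inter> (M \<union> T) = {}")
      case True
      then show ?thesis using X by (intro image_eqI[of _ _ "(False, X)"]) (auto simp: E0_def)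
    next
      case False
      then show ?thesis using X by (intro image_eqI[of _ _ "(True, X \<inter> K)"]) (auto simp: E0_def)
    qed
  qed
  have finE0: "finite E0" using E0_sub by (rule finite_subset) (use fin' in auto)
  have "card E0 \<le> card ((\<lambda>(c, Y). if c then M \<union> T \<union> Y else Y) ` ((UNIV :: bool set) \<times> Pow K))"
    using E0_sub fin' by (intro card_mono) auto
  also have "\<dots> \<le> card ((UNIV :: bool set) \<times> Pow K)" using fin' by (intro card_image_le) auto
  also have "\<dots> = 2 * 2 ^ card K" using fin' by (simp add: card_cartesian_product card_Pow)
  finally have cE0: "card E0 \<le> 2 * 2 ^ card K" .
  \<comment> \<open>As many remaining sets as split into groups of \<open>card A\<close>; the rest
    is a remainder modulo \<open>card A\<close>.\<close>
  obtain E1 where E1: "E1 \<subseteq> E0" "card E1 = ?p * (card E0 div ?p)"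
    by (metis obtain_subset_with_card_n times_div_less_eq_dividend)
  have finE1: "finite E1" using E1(1) finE0 finite_subset by blast
  have "card (E0 - E1) = card E0 mod ?p"
    using E1 finE1 by (simp add: card_Diff_subset minus_mult_div_eq_mod)
  then have left: "card (E0 - E1) \<le> ?p - 1" using card_pos by (simp add: Suc_leI le_diff_conv2 flip: less_Suc_eq_le)
  obtain \<G> where \<G>: "partition_on E1 \<G>" "\<And>G. G \<in> \<G> \<Longrightarrow> card G = ?p"
    using partition_into_blocks[OF finE1 _ card_pos] E1(2) by (metis dvd_triv_left)
  have "card \<G> \<le> card E1"
  proof (rule card_inj_on_le)
    have some: "(SOME x. x \<in> G) \<in> G" if "G \<in> \<G>" for G
      using partition_onD3[OF \<G>(1)] that by (metis equals0I someI)
    show "inj_on (\<lambda>G. SOME x. x \<in> G) \<G>"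
    proof (rule inj_onI)
      fix G G' assume G: "G \<in> \<G>" "G' \<in> \<G>" "(SOME x. x \<in> G) = (SOME x. x \<in> G')"
      then have "(SOME x. x \<in> G) \<in> G \<inter> G'" using some[OF G(1)] some[OF G(2)] by simp
      then show "G = G'" using disjointD[OF partition_onD2[OF \<G>(1)] G(1,2)] by blast
    qed
    show "(\<lambda>G. SOME x. x \<in> G) ` \<G> \<subseteq> E1" using some partition_onD1[OF \<G>(1)] by blast
  qed (fact finE1)
  also have "\<dots> \<le> card E0" using finE0 E1(1) by (rule card_mono)
  finally have c\<G>: "card \<G> \<le> 2 * 2 ^ card K" using cE0 by linarith
  have fin\<G>: "finite \<G>" using finE1 \<G>(1) finite_elements by blast
  have "card (\<G> <+> (A <+> A)) \<le> card T"
    using T c\<G> fin fin\<G> by (simp add: card_Plus)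
  then obtain \<tau> where \<tau>: "\<tau> ` (\<G> <+> (A <+> A)) \<subseteq> T" "inj_on \<tau> (\<G> <+> (A <+> A))"
    using card_le_inj[of "\<G> <+> (A <+> A)" T] fin fin\<G> fin' by auto
  \<comment> \<open>The points of \<open>T\<close> carry one label per group and two copies of
    \<open>A\<close>. So \<open>z\<close> is the product order on pairs \<open>i\<close>,
    \<open>v\<close> within a group, and different groups are incomparable.\<close>
  define z where "z = (\<lambda>G i v. \<tau> ` ({G} <+> (dn i <+> dn v)))"
  have z_T: "z G i v \<subseteq> T" if "G \<in> \<G>" for G i v
    using \<tau>(1) that unfolding z_def dn_def by blast
  have z_iff: "z G i v \<subseteq> z G' i' v' \<longleftrightarrow> G = G' \<and> (i, i') \<in> r \<and> (v, v') \<in> r"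
    if "G \<in> \<G>" "G' \<in> \<G>" "i \<in> A" "i' \<in> A" "v \<in> A" "v' \<in> A" for G G' i i' v v'
  proof -
    have s: "{H} <+> (dn a <+> dn b) \<subseteq> \<G> <+> (A <+> A)" if "H \<in> \<G>" for H a b
      using that by (auto simp: dn_def)
    have "z G i v \<subseteq> z G' i' v' \<longleftrightarrow> {G} <+> (dn i <+> dn v) \<subseteq> {G'} <+> (dn i' <+> dn v')"
      unfolding z_def by (rule image_subset_image_iff[OF \<tau>(2) s[OF that(1)] s[OF that(2)]])
    also have "\<dots> \<longleftrightarrow> G = G' \<and> dn i \<subseteq> dn i' \<and> dn v \<subseteq> dn v'" by auto
    finally show ?thesis using dn_subset_iff that by simp
  qed
  have "\<forall>G\<in>\<G>. \<exists>f. bij_betw f A G \<and> (\<forall>i\<in>A. \<forall>i'\<in>A. (i, i') \<in> r \<longrightarrow> f i' \<inter> M = {} \<longrightarrow> f i \<inter> M = {})"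
    using ex_bij_down_set[where P = "\<lambda>X. X \<inter> M = {}"] \<G>(2) by blast
  then obtain \<omega> where \<omega>: "\<And>G. G \<in> \<G> \<Longrightarrow> bij_betw (\<omega> G) A G"
    and \<omega>_down: "\<And>G i i'. G \<in> \<G> \<Longrightarrow> i \<in> A \<Longrightarrow> i' \<in> A \<Longrightarrow> (i, i') \<in> r \<Longrightarrow> \<omega> G i' \<inter> M = {} \<Longrightarrow> \<omega> G i \<inter> M = {}"
    by metis
  have M: "M \<noteq> {}" using f0(2) ne by blast
  have \<omega>_G: "\<omega> G i \<in> G" if "G \<in> \<G>" "i \<in> A" for G i using bij_betwE[OF \<omega>] that by blast
  have \<omega>_E1: "\<omega> G i \<in> E1" if "G \<in> \<G>" "i \<in> A" for G i
    using \<omega>_G[OF that] partition_onD1[OF \<G>(1)] that by blast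
  have \<omega>_zero: "\<omega> G i \<subseteq> K \<and> \<omega> G i \<noteq> {}" if "G \<in> \<G>" "i \<in> A" "\<omega> G i \<inter> M = {}" for G i
    using \<omega>_E1[OF that(1,2)] E1(1) that(3) M unfolding E0_def by blast
  have \<omega>_one: "M \<union> T \<subseteq> \<omega> G i \<and> \<omega> G i \<subseteq> M \<union> T \<union> K \<and> \<not> K \<subseteq> \<omega> G i"
    if "G \<in> \<G>" "i \<in> A" "\<omega> G i \<inter> M \<noteq> {}" for G i
    using \<omega>_E1[OF that(1,2)] E1(1) that(3) unfolding E0_def by blast
  have \<omega>_inj: "G = G' \<and> i = i'" if "G \<in> \<G>" "G' \<in> \<G>" "i \<in> A" "i' \<in> A" "\<omega> G i = \<omega> G' i'" for G G' i i'
  proof -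
    have "\<omega> G i \<in> G \<inter> G'" using \<omega>_G[OF that(1,3)] \<omega>_G[OF that(2,4)] that(5) by simp
    then have "G = G'" using partition_onD2[OF \<G>(1)] that(1,2) unfolding disjoint_def by blast
    then show ?thesis using \<omega>[OF that(1)] that unfolding bij_betw_def by (auto dest: inj_onD)
  qed
  obtain x0 x1 where x: "x0 \<in> A" "x1 \<in> A" "(x0, x1) \<in> r"
    and x0: "\<And>v. v \<in> A \<Longrightarrow> (v, x0) \<in> r \<Longrightarrow> v = x0" and x1: "\<And>v. v \<in> A \<Longrightarrow> (x1, v) \<in> r \<Longrightarrow> v = x1"
    using ex_min_below_max by metis
  define role where "role = (\<lambda>G i. if \<omega> G i \<inter> M = {} then x0 else x1)"
  \<comment> \<open>The trace on \<open>K\<close> tunes comparison with \<open>\<omega> G i\<close>: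
    a cell contains it exactly for \<open>v\<close> strictly above \<open>x0\<close>, or is
    contained in it exactly for \<open>v\<close> strictly below \<open>x1\<close>. At the role
    itself \<open>s\<close> is \<open>{}\<close> or \<open>K\<close>, which makes the cells given up
    monotone.\<close>
  define s where "s = (\<lambda>G i v. if \<omega> G i \<inter> M = {}
    then (if (x0, v) \<in> r \<and> v \<noteq> x0 then \<omega> G i \<inter> K else {})
    else (if (v, x1) \<in> r \<and> v \<noteq> x1 then \<omega> G i \<inter> K else K))"
  define \<eta> where "\<eta> = (\<lambda>G i v. z G i v \<union> s G i v)"
  define cell where "cell = (\<lambda>G i t v. f0 t \<union> \<eta> G i v)"
  have role: "role G i \<in> A" for G i using x by (simp add: role_def)
  have s_K: "s G i v \<subseteq> K" for G i v by (auto simp: s_def)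
  have s_mono: "s G i v \<subseteq> s G i v'" if "(v, v') \<in> r" "v \<in> A" "v' \<in> A" for G i v v'
  proof (cases "\<omega> G i \<inter> M = {}")
    case True
    have "(x0, v') \<in> r \<and> v' \<noteq> x0" if "(x0, v) \<in> r" "v \<noteq> x0"
      using r_trans[OF that(1) \<open>(v, v') \<in> r\<close>] x0[of v] \<open>(v, v') \<in> r\<close> \<open>v \<in> A\<close> that(2) by blast
    then show ?thesis using True by (simp add: s_def)
  next
    case False
    have "(v, x1) \<in> r \<and> v \<noteq> x1" if "(v', x1) \<in> r" "v' \<noteq> x1"
      using r_trans[OF \<open>(v, v') \<in> r\<close> that(1)] x1[of v'] \<open>(v, v') \<in> r\<close> \<open>v' \<in> A\<close> that(2) by blast
    then show ?thesis using False by (simp add: s_def)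
  qed
  have \<eta>_T: "\<eta> G i v \<subseteq> T \<union> K" if "G \<in> \<G>" for G i v using z_T[OF that] s_K unfolding \<eta>_def by blast
  have \<eta>_le: "\<eta> G i v \<subseteq> \<eta> G' i' v' \<longleftrightarrow> (G = G' \<and> (i, i') \<in> r \<and> (v, v') \<in> r) \<and> s G i v \<subseteq> s G' i' v'"
    if "G \<in> \<G>" "G' \<in> \<G>" "i \<in> A" "i' \<in> A" "v \<in> A" "v' \<in> A" for G G' i i' v v'
    unfolding \<eta>_def z_iff[OF that, symmetric]
    by (rule Un_subset_Un_iff[OF z_T[OF that(1)] z_T[OF that(2)] s_K s_K disj(3)])
  have MTK: "M \<inter> (T \<union> K) = {}" using disj by blast
  have cell_le: "cell G i t v \<subseteq> cell G' i' t' v' \<longleftrightarrow> (t, t') \<in> r \<and> \<eta> G i v \<subseteq> \<eta> G' i' v'"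
    if "G \<in> \<G>" "G' \<in> \<G>" "t \<in> A" "t' \<in> A" for G G' i i' t t' v v'
    unfolding cell_def embD[OF f0(1) that(3,4)] using that f0(2)
    by (intro Un_subset_Un_iff[OF _ _ \<eta>_T[OF that(1)] \<eta>_T[OF that(2)] MTK]) auto
  have cell_inj: "G = G' \<and> i = i' \<and> t = t' \<and> v = v'"
    if "G \<in> \<G>" "G' \<in> \<G>" "i \<in> A" "i' \<in> A" "t \<in> A" "t' \<in> A" "v \<in> A" "v' \<in> A"
      "cell G i t v = cell G' i' t' v'" for G G' i i' t t' v v'
  proof -
    have "cell G i t v \<subseteq> cell G' i' t' v'" "cell G' i' t' v' \<subseteq> cell G i t v" using that(9) by auto
    then have "(t, t') \<in> r" "(t', t) \<in> r" "\<eta> G i v \<subseteq> \<eta> G' i' v'" "\<eta> G' i' v' \<subseteq> \<eta> G i v"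
      using cell_le[OF that(1,2,5,6), of i v i' v'] cell_le[OF that(2,1,6,5), of i' v' i v] by blast+
    then show ?thesis
      using \<eta>_le[OF that(1-4,7,8)] \<eta>_le[OF that(2,1,4,3,8,7)] r_antisym by blast
  qed
  have cell_M: "cell G i t v \<inter> M = f0 t" if "G \<in> \<G>" "t \<in> A" for G i t v
    using \<eta>_T[OF that(1)] f0(2)[OF that(2)] MTK unfolding cell_def by blast
  have \<omega>_cell: "\<omega> G i \<noteq> cell G' i' t v" if "G \<in> \<G>" "G' \<in> \<G>" "i \<in> A" "t \<in> A" for G G' i i' t v
  proof
    assume "\<omega> G i = cell G' i' t v"
    then have "\<omega> G i \<inter> M = f0 t" using cell_M[OF that(2,4)] by simp
    moreover have "\<omega> G i \<inter> M = {} \<or> \<omega> G i \<inter> M = M" using \<omega>_one[OF that(1,3)] by blast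
    ultimately show False using f0(2)[OF that(4)] by simp
  qed
  \<comment> \<open>Columns fix \<open>t\<close> and vary \<open>v\<close>, whereas the original
    tiles vary \<open>t\<close>. Only the column \<open>t = x0\<close> takes in
    \<open>\<omega> G i\<close>.\<close>
  define col where "col = (\<lambda>G i t v. if t = x0 \<and> v = role G i then \<omega> G i else cell G i t v)"
  have emb_col: "emb (col G i t)" if G: "G \<in> \<G>" and i: "i \<in> A" and t: "t \<in> A" for G i t
  proof (rule embI)
    fix v v' assume v: "v \<in> A" "v' \<in> A"
    have cc: "cell G i t v \<subseteq> cell G i t v' \<longleftrightarrow> (v, v') \<in> r" if "v \<in> A" "v' \<in> A" for v v'
      using cell_le[OF G G t t] \<eta>_le[OF G G i i that] s_mono[OF _ that] r_refl i t by blast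
    have rho: "s G i v \<subseteq> K" "f0 t \<subseteq> M" "f0 t \<noteq> {}" "f0 t \<noteq> M" "z G i v \<subseteq> T" for v
      using s_K f0(2)[OF t] z_T[OF G] by auto
    show "(v, v') \<in> r \<longleftrightarrow> col G i t v \<le> col G i t v'"
    proof (cases "\<omega> G i \<inter> M = {}")
      case True
      then have w: "\<omega> G i \<subseteq> K" "\<omega> G i \<noteq> {}" using \<omega>_zero G i by auto
      have up: "\<omega> G i \<subseteq> cell G i t v \<longleftrightarrow> (x0, v) \<in> r" if "v \<noteq> x0" for v
      proof -
        have "\<omega> G i \<inter> f0 t = {}" using w(1) rho(2) disj(2) by blast
        moreover have "\<omega> G i \<inter> z G i v = {}" using w(1) rho(5)[of v] disj(3) by blast
        ultimately have "\<omega> G i \<subseteq> cell G i t v \<longleftrightarrow> \<omega> G i \<subseteq> s G i v"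
          unfolding cell_def \<eta>_def by blast
        also have "\<dots> \<longleftrightarrow> (x0, v) \<in> r" using True w that by (auto simp: s_def)
        finally show ?thesis .
      qed
      have dn: "\<not> cell G i t v \<subseteq> \<omega> G i" for v
      proof -
        have "\<not> f0 t \<subseteq> \<omega> G i" using rho(2,3) w(1) disj(2) by blast
        then show ?thesis unfolding cell_def by blast
      qed
      show ?thesis
        using True v up dn cc x0[of v] r_refl[of x0] x(1) by (auto simp: col_def role_def)
    next
      case False
      then have w: "M \<union> T \<subseteq> \<omega> G i" "\<not> K \<subseteq> \<omega> G i" using \<omega>_one G i by auto
      have dn: "cell G i t v \<subseteq> \<omega> G i \<longleftrightarrow> (v, x1) \<in> r" if "v \<noteq> x1" for v
      proof -
        have "f0 t \<subseteq> \<omega> G i" "z G i v \<subseteq> \<omega> G i" using w(1) rho(2) rho(5)[of v] by blast+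
        then have "cell G i t v \<subseteq> \<omega> G i \<longleftrightarrow> s G i v \<subseteq> \<omega> G i"
          unfolding cell_def \<eta>_def by blast
        also have "\<dots> \<longleftrightarrow> (v, x1) \<in> r" using False w that by (auto simp: s_def)
        finally show ?thesis .
      qed
      have up: "\<not> \<omega> G i \<subseteq> cell G i t v" for v
      proof
        assume "\<omega> G i \<subseteq> cell G i t v"
        then have "M \<subseteq> cell G i t v \<inter> M" using w(1) by blast
        then have "M \<subseteq> f0 t" unfolding cell_M[OF G t] .
        then show False using rho(2,4) by blast
      qed
      show ?thesis
        using False v up dn cc x1[of v'] r_refl[of x1] x(2) by (auto simp: col_def role_def)
    qed
  qed
  define swap where "swap = (\<lambda>G i. cell G i x0 (role G i))"
  have emb_swap: "emb (swap G)" if G: "G \<in> \<G>" for G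
  proof (rule embI)
    fix i i' assume i: "i \<in> A" "i' \<in> A"
    have "swap G i \<subseteq> swap G i' \<longleftrightarrow> (i, i') \<in> r \<and> (role G i, role G i') \<in> r \<and> s G i (role G i) \<subseteq> s G i' (role G i')"
      unfolding swap_def using cell_le[OF G G x(1) x(1)] \<eta>_le[OF G G i role role] r_refl[OF x(1)] by simp
    \<comment> \<open>By \<open>\<omega>_down\<close> the kinds either agree or pass from avoiding
      to containing \<open>M\<close>, where \<open>x0\<close> lies below \<open>x1\<close> and
      \<open>{}\<close> in \<open>K\<close>.\<close>
    moreover have "(role G i, role G i') \<in> r" "s G i (role G i) \<subseteq> s G i' (role G i')" if "(i, i') \<in> r"
      using \<omega>_down[OF G i that] x r_refl by (auto simp: role_def s_def)
    ultimately show "(i, i') \<in> r \<longleftrightarrow> swap G i \<le> swap G i'" by blast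
  qed
  let ?I = "\<G> \<times> A \<times> A"
  have tile_cols: "tile (\<Union>(G, i, t)\<in>?I. col G i t ` A)"
  proof (rule tile_UN)
    show "tile (case j of (G, i, t) \<Rightarrow> col G i t ` A)" if "j \<in> ?I" for j
      using that emb_col tile_emb by auto
    have ne: "col G i t v \<noteq> col G' i' t' v'"
      if "G \<in> \<G>" "G' \<in> \<G>" "i \<in> A" "i' \<in> A" "t \<in> A" "t' \<in> A" "v \<in> A" "v' \<in> A" "(G, i, t) \<noteq> (G', i', t')"
      for G G' i i' t t' v v'
    proof
      assume eq: "col G i t v = col G' i' t' v'"
      consider "t = x0 \<and> v = role G i" "t' = x0 \<and> v' = role G' i'"
        | "\<not> (t = x0 \<and> v = role G i)" "t' = x0 \<and> v' = role G' i'"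
        | "t = x0 \<and> v = role G i" "\<not> (t' = x0 \<and> v' = role G' i')"
        | "\<not> (t = x0 \<and> v = role G i)" "\<not> (t' = x0 \<and> v' = role G' i')" by blast
      then show False
      proof cases
        case 1
        then have "\<omega> G i = \<omega> G' i'" using eq by (simp add: col_def)
        then show False using \<omega>_inj[OF that(1-4)] 1 that(9) by blast
      next
        case 2
        then have "\<omega> G' i' = cell G i t v" using eq unfolding col_def by presburger
        then show False using \<omega>_cell[OF that(2,1,4,5)] by blast
      next
        case 3
        then have "\<omega> G i = cell G' i' t' v'" using eq unfolding col_def by presburger
        then show False using \<omega>_cell[OF that(1,2,3,6)] by blast
      next
        case 4
        then have "cell G i t v = cell G' i' t' v'" using eq unfolding col_def by presburger
        then show False using cell_inj[OF that(1-8)] that(9) by blast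
      qed
    qed
    show "disjoint_family_on (\<lambda>j. case j of (G, i, t) \<Rightarrow> col G i t ` A) ?I"
      unfolding disjoint_family_on_def
    proof (intro ballI impI)
      fix j j' assume j: "j \<in> ?I" "j' \<in> ?I" "j \<noteq> j'"
      obtain G i t G' i' t' where jj: "j = (G, i, t)" "j' = (G', i', t')" by (metis prod_cases3)
      have "col G i t v \<noteq> col G' i' t' v'" if "v \<in> A" "v' \<in> A" for v v'
        by (rule ne) (use j jj that in simp_all)
      then show "(case j of (G, i, t) \<Rightarrow> col G i t ` A) \<inter> (case j' of (G, i, t) \<Rightarrow> col G i t ` A) = {}"
        unfolding jj prod.case by blast
    qed
  qed
  have tile_swaps: "tile (\<Union>G\<in>\<G>. swap G ` A)"
  proof (rule tile_UN)
    show "tile (swap G ` A)" if "G \<in> \<G>" for G using emb_swap[OF that] by (rule tile_emb)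
    have "swap G i \<noteq> swap G' i'" if "G \<in> \<G>" "G' \<in> \<G>" "i \<in> A" "i' \<in> A" "G \<noteq> G'" for G G' i i'
      using cell_inj[OF that(1-4) x(1) x(1) role role] that(5) unfolding swap_def by blast
    then show "disjoint_family_on (\<lambda>G. swap G ` A) \<G>"
      unfolding disjoint_family_on_def by blast
  qed
  have ne: "col G i t v \<noteq> swap G' i'" if "G \<in> \<G>" "G' \<in> \<G>" "i \<in> A" "i' \<in> A" "t \<in> A" "v \<in> A" for G G' i i' t v
    using cell_inj[OF that(1-5) x(1) that(6) role] \<omega>_cell[OF that(1,2,3) x(1)] unfolding swap_def col_def
    by (cases "t = x0 \<and> v = role G i") auto
  have "(\<Union>(G, i, t)\<in>?I. col G i t ` A) \<inter> (\<Union>G\<in>\<G>. swap G ` A) = {}"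
  proof (rule equals0I)
    fix X assume "X \<in> (\<Union>(G, i, t)\<in>?I. col G i t ` A) \<inter> (\<Union>G\<in>\<G>. swap G ` A)"
    then obtain G i t v G' i' where "X = col G i t v" "G \<in> \<G>" "i \<in> A" "t \<in> A" "v \<in> A"
      "X = swap G' i'" "G' \<in> \<G>" "i' \<in> A" by (elim IntE UN_E) auto
    then show False using ne by metis
  qed
  then have "tile ((\<Union>(G, i, t)\<in>?I. col G i t ` A) \<union> (\<Union>G\<in>\<G>. swap G ` A))"
    using tile_Un tile_cols tile_swaps by blast
  moreover define Cs where "Cs = {cell G i t v | G i t v. G \<in> \<G> \<and> i \<in> A \<and> t \<in> A \<and> v \<in> A}"
  have "(\<Union>(G, i, t)\<in>?I. col G i t ` A) \<union> (\<Union>G\<in>\<G>. swap G ` A) = Cs \<union> E1"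
  proof (intro equalityI subsetI)
    fix X assume "X \<in> (\<Union>(G, i, t)\<in>?I. col G i t ` A) \<union> (\<Union>G\<in>\<G>. swap G ` A)"
    then consider G i t v where "X = col G i t v" "G \<in> \<G>" "i \<in> A" "t \<in> A" "v \<in> A"
      | G i where "X = swap G i" "G \<in> \<G>" "i \<in> A" by blast
    then show "X \<in> Cs \<union> E1"
    proof cases
      case 1
      then show ?thesis using \<omega>_E1 unfolding col_def Cs_def by (auto split: if_splits)
    next
      case 2
      then show ?thesis using x(1) role unfolding swap_def Cs_def by blast
    qed
  next
    fix X assume "X \<in> Cs \<union> E1"
    then show "X \<in> (\<Union>(G, i, t)\<in>?I. col G i t ` A) \<union> (\<Union>G\<in>\<G>. swap G ` A)"
    proof
      assume "X \<in> Cs"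
      then obtain G i t v where X: "X = cell G i t v" "G \<in> \<G>" "i \<in> A" "t \<in> A" "v \<in> A"
        unfolding Cs_def by blast
      show ?thesis
      proof (cases "t = x0 \<and> v = role G i")
        case True
        then have "X = swap G i" using X(1) by (simp add: swap_def)
        then show ?thesis using X(2,3) by blast
      next
        case False
        then have "X = col G i t v" unfolding col_def using X(1) by presburger
        then show ?thesis using X(2-5) by blast
      qed
    next
      assume "X \<in> E1"
      then obtain G where G: "G \<in> \<G>" "X \<in> G" using partition_onD1[OF \<G>(1)] by blast
      then obtain i where i: "i \<in> A" "X = \<omega> G i" using \<omega> by (metis bij_betw_imp_surj_on imageE)
      then have "X = col G i x0 (role G i)" by (simp add: col_def)
      then show ?thesis using G(1) i(1) x(1) role by blast
    qed
  qed
  ultimately have tile1: "tile (Cs \<union> E1)" by simp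
  \<comment> \<open>The tiles over these points were broken up into cells; the tiles over all other
    \<open>Y\<close> stay intact.\<close>
  define Rs where "Rs = {\<eta> G i v | G i v. G \<in> \<G> \<and> i \<in> A \<and> v \<in> A}"
  have tile2: "tile (\<Union>Y\<in>Pow (T \<union> K) - Rs. (\<lambda>t. f0 t \<union> Y) ` A)"
  proof (rule tile_UN)
    have le: "f0 t \<union> Y \<subseteq> f0 t' \<union> Y' \<longleftrightarrow> (t, t') \<in> r \<and> Y \<subseteq> Y'"
      if "t \<in> A" "t' \<in> A" "Y \<subseteq> T \<union> K" "Y' \<subseteq> T \<union> K" for t t' Y Y'
      unfolding embD[OF f0(1) that(1,2)]
      using f0(2) that by (intro Un_subset_Un_iff[OF _ _ _ _ MTK]) auto
    show "tile ((\<lambda>t. f0 t \<union> Y) ` A)" if "Y \<in> Pow (T \<union> K) - Rs" for Y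
    proof (intro tile_emb embI)
      fix t t' assume "t \<in> A" "t' \<in> A"
      then show "(t, t') \<in> r \<longleftrightarrow> f0 t \<union> Y \<le> f0 t' \<union> Y" using le[of t t' Y Y] that by blast
    qed
    have "f0 t \<union> Y \<noteq> f0 t' \<union> Y'" if "t \<in> A" "t' \<in> A" "Y \<subseteq> T \<union> K" "Y' \<subseteq> T \<union> K" "Y \<noteq> Y'" for t t' Y Y'
      using le[OF that(1-4)] le[OF that(2,1,4,3)] that(5) by blast
    then have "(\<lambda>t. f0 t \<union> Y) ` A \<inter> (\<lambda>t. f0 t \<union> Y') ` A = {}"
      if "Y \<subseteq> T \<union> K" "Y' \<subseteq> T \<union> K" "Y \<noteq> Y'" for Y Y' using that by blast
    then show "disjoint_family_on (\<lambda>Y. (\<lambda>t. f0 t \<union> Y) ` A) (Pow (T \<union> K) - Rs)"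
      unfolding disjoint_family_on_def by simp
  qed
  have sep: "Y = Y'" if "t \<in> A" "t' \<in> A" "Y \<subseteq> T \<union> K" "Y' \<subseteq> T \<union> K" "f0 t \<union> Y = f0 t' \<union> Y'" for t t' Y Y'
    using that f0(2) MTK by blast
  have E1_M: "X \<inter> M = {} \<or> M \<subseteq> X" if "X \<in> E1" for X
    using that E1(1) unfolding E0_def by blast
  have "(Cs \<union> E1) \<inter> (\<Union>Y\<in>Pow (T \<union> K) - Rs. (\<lambda>t. f0 t \<union> Y) ` A) = {}"
  proof -
    have "f0 t \<union> Y \<notin> Cs \<union> E1" if Y: "Y \<subseteq> T \<union> K" "Y \<notin> Rs" and t: "t \<in> A" for t Y
    proof
      assume "f0 t \<union> Y \<in> Cs \<union> E1"
      then show False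
      proof
        assume "f0 t \<union> Y \<in> Cs"
        then obtain G i t' v where c: "f0 t \<union> Y = f0 t' \<union> \<eta> G i v" "G \<in> \<G>" "i \<in> A" "t' \<in> A" "v \<in> A"
          unfolding Cs_def cell_def by blast
        then have "Y = \<eta> G i v" using sep[OF t c(4) Y(1) \<eta>_T[OF c(2)]] by blast
        then show False using Y(2) c unfolding Rs_def by blast
      next
        assume "f0 t \<union> Y \<in> E1"
        then show False using E1_M[of "f0 t \<union> Y"] f0(2)[OF t] Y(1) MTK by blast
      qed
    qed
    then show ?thesis by blast
  qed
  then have "tile ((Cs \<union> E1) \<union> (\<Union>Y\<in>Pow (T \<union> K) - Rs. (\<lambda>t. f0 t \<union> Y) ` A))"
    using tile_Un tile1 tile2 by blast
  also have "(Cs \<union> E1) \<union> (\<Union>Y\<in>Pow (T \<union> K) - Rs. (\<lambda>t. f0 t \<union> Y) ` A)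
    = {X \<union> Y | X Y. X \<in> f0 ` A \<and> Y \<subseteq> T \<union> K} \<union> E1"
  proof -
    have "Cs = (\<Union>Y\<in>Rs. (\<lambda>t. f0 t \<union> Y) ` A)"
      unfolding Cs_def Rs_def cell_def by blast
    moreover have "Rs \<subseteq> Pow (T \<union> K)" using \<eta>_T unfolding Rs_def by blast
    ultimately have 1: "Cs \<union> (\<Union>Y\<in>Pow (T \<union> K) - Rs. (\<lambda>t. f0 t \<union> Y) ` A) = (\<Union>Y\<in>Pow (T \<union> K). (\<lambda>t. f0 t \<union> Y) ` A)"
      by blast
    have 2: "(\<Union>Y\<in>Pow (T \<union> K). (\<lambda>t. f0 t \<union> Y) ` A) = {X \<union> Y | X Y. X \<in> f0 ` A \<and> Y \<subseteq> T \<union> K}"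
      by blast
    have "(X \<union> E1) \<union> Y = (X \<union> Y) \<union> E1" for X Y by blast
    then show ?thesis by (simp only: 1 2)
  qed
  finally show ?thesis using E1(1) left by blast
qed

section \<open>Assembling the tiling of the middle cube\<close>

lemma tile_assemble:
  assumes "tile (R - (P \<union> P'))" "tile P" "tile (P' \<union> S)" "P \<inter> P' = {}" "P \<union> P' \<subseteq> R" "R \<inter> S = {}"
  shows "tile (R \<union> S)"
proof -
  have "P \<inter> (P' \<union> S) = {}" "(R - (P \<union> P')) \<inter> (P \<union> (P' \<union> S)) = {}" using assms(4-6) by blast+
  then have "tile ((R - (P \<union> P')) \<union> (P \<union> (P' \<union> S)))" using assms(1-3) tile_Un by metis
  also have "(R - (P \<union> P')) \<union> (P \<union> (P' \<union> S)) = R \<union> S" using assms(5) by blast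
  finally show ?thesis .
qed

text \<open>The ground set splits into \<open>B\<close> and a small \<open>K\<close>, and
  \<open>B\<close> into an \<open>m\<close>-set \<open>M1\<close>, free points \<open>M0\<close> and
  a huge \<open>T0\<close>. One tile of the region of \<open>M1\<close> and \<open>M0\<close>,
  spread over \<open>T0\<close> and \<open>K\<close>, serves to absorb the sets that avoid or
  contain \<open>B\<close>.\<close>

lemma ex_tile_middle_cube:
  "\<exists>n0. \<forall>n\<ge>n0. \<exists>X\<subseteq>middle_cube n. tile X \<and> card (middle_cube n - X) \<le> card A - 1"
proof -
  obtain m k0 :: nat where m: "m \<ge> 3"
    and T: "\<And>B K :: nat set. finite B \<Longrightarrow> finite K \<Longrightarrow> B \<inter> K = {} \<Longrightarrow> card B = m \<Longrightarrow> k0 \<le> card K \<Longrightarrow> tile (Reg B K)"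
    using ex_tile_Reg by metis
  let ?c = "2 * 2 ^ (k0 + m) + 2 * card A"
  have "\<exists>X\<subseteq>middle_cube n. tile X \<and> card (middle_cube n - X) \<le> card A - 1"
    if n: "n \<ge> 2 * k0 + 2 * m + ?c + 1" for n
  proof -
    \<comment> \<open>Chosen in a bounded range so that \<open>n - k\<close> is 1 modulo
      \<open>m - 1\<close>, a size that blowing up reaches.\<close>
    define k where "k = k0 + (n - k0 - 1) mod (m - 1)"
    define t where "t = (n - k0 - 1) div (m - 1)"
    have "(n - k0 - 1) mod (m - 1) < m - 1" using m by (intro mod_less_divisor) simp
    then have k: "k0 \<le> k" "k < k0 + m" unfolding k_def by linarith+
    have tk: "n = 1 + t * (m - 1) + k"
    proof -
      have "t * (m - 1) + (n - k0 - 1) mod (m - 1) = n - k0 - 1"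
        unfolding t_def by (rule div_mult_mod_eq)
      moreover have "k0 + 1 \<le> n" using n by simp
      ultimately show ?thesis unfolding k_def by linarith
    qed
    have t0: "t > 0"
    proof (rule ccontr)
      assume "\<not> t > 0"
      then have "n = 1 + k" using tk by simp
      then show False using n k by simp
    qed
    obtain K where K: "K \<subseteq> {1..n}" "card K = k"
      using obtain_subset_with_card_n[of k "{1..n}"] tk by auto
    define B where "B = {1..n} - K"
    have finK: "finite K" "finite B" using K(1) finite_subset by (auto simp: B_def)
    have cB: "card B = 1 + t * (m - 1)" using K finK tk by (simp add: B_def card_Diff_subset)
    have "m \<le> card B" using cB t0 m by (cases t) auto
    then obtain M1 where M1: "M1 \<subseteq> B" "card M1 = m" using obtain_subset_with_card_n by metis
    have "k0 \<le> card (B - M1)"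
      using M1 finK cB tk n k finite_subset[OF M1(1)] by (simp add: card_Diff_subset)
    then obtain M0 where M0: "M0 \<subseteq> B - M1" "card M0 = k0" using obtain_subset_with_card_n by metis
    define T0 where "T0 = B - M1 - M0"
    define M where "M = M1 \<union> M0"
    have fins: "finite M1" "finite M0" "finite T0"
      using finite_subset[OF _ finK(2)] M1(1) M0(1) by (auto simp: T0_def)
    have "card (B - M1) = card B - m" using M1 fins by (simp add: card_Diff_subset)
    moreover have "card T0 = card (B - M1) - k0" using M0 fins by (simp add: T0_def card_Diff_subset)
    ultimately have "card T0 = n - k - m - k0" using cB tk by simp
    then have "?c \<le> card T0" using n k by simp
    moreover have "(2::nat) ^ card K \<le> 2 ^ (k0 + m)" using K(2) k by (intro power_increasing) auto
    ultimately have cT: "2 * 2 ^ card K + 2 * card A \<le> card T0" by linarith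
    have BM: "B = M \<union> T0" "M1 \<subseteq> M" using M1 M0 by (auto simp: M_def T0_def)
    have disj: "M \<inter> T0 = {}" "M \<inter> K = {}" "T0 \<inter> K = {}" "B \<inter> K = {}" "M1 \<inter> M0 = {}"
      using M1 M0 by (auto simp: M_def T0_def B_def)
    have "M1 \<noteq> {}" using M1 m by auto
    then obtain e where e: "e \<in> M1" by blast
    \<comment> \<open>Contracting \<open>M1\<close> to \<open>e\<close> undoes one blow-up, hence
      \<open>t - 1\<close>.\<close>
    have "tile (Reg (insert e (B - M1)) K)"
    proof (rule tile_Reg_blow_up[OF T m])
      obtain t' where t': "t = Suc t'" using t0 by (cases t) auto
      show "card (insert e (B - M1)) = 1 + (t - 1) * (m - 1)"
        using \<open>card (B - M1) = card B - m\<close> cB t' e finK m by (simp add: card_insert_if)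
      show "insert e (B - M1) \<inter> K = {}" using e M1 disj by blast
    qed (use finK K k in auto)
    then have 1: "tile (Reg B K - Reg M1 (B - M1 \<union> K))"
      using tile_Reg_blow_up_step M1 e disj by metis
    have "tile (Reg M1 M0)" using T[of M1 M0] fins disj M1 M0 by simp
    \<comment> \<open>The region is nonempty and therefore has a tile to set aside.\<close>
    moreover have "M1 - {e} \<in> Reg M1 M0"
    proof -
      have "card (M1 - {e}) \<noteq> 0" using M1 e fins m by simp
      then have "M1 - {e} \<noteq> {}" by (metis card.empty)
      then show ?thesis using e by (auto simp: Reg_def)
    qed
    ultimately obtain f0 where f0: "emb f0" "f0 ` A \<subseteq> Reg M1 M0" "tile (Reg M1 M0 - f0 ` A)"
      using tile_obtain[of "Reg M1 M0"] by blast
    let ?L = "T0 \<union> K"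
    let ?sp = "\<lambda>Z. {X \<union> Y | X Y. X \<in> Z \<and> Y \<subseteq> ?L}"
    have disjL: "M \<inter> ?L = {}" using disj by blast
    have RM: "Reg M1 M0 \<subseteq> Pow M" by (auto simp: Reg_def M_def)
    have 2: "tile (?sp (Reg M1 M0 - f0 ` A))"
      using RM disjL by (intro tile_spread[OF f0(3), of M]) auto
    have BL: "B - M1 \<union> K = M0 \<union> ?L" using M1 M0 by (auto simp: T0_def)
    have RL: "Reg M1 (B - M1 \<union> K) = ?sp (Reg M1 M0)"
      unfolding BL using disjL by (intro Reg_extend) (auto simp: M_def)
    define E0 where "E0 = {X. X \<subseteq> M \<union> T0 \<union> K \<and> (X \<inter> (M \<union> T0) = {} \<or> M \<union> T0 \<subseteq> X)} - {{}, M \<union> T0 \<union> K}"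
    have f0M: "f0 t \<subseteq> M \<and> f0 t \<noteq> {} \<and> f0 t \<noteq> M" if "t \<in> A" for t
    proof -
      have "f0 t \<in> Reg M1 M0" using f0(2) that by blast
      then have "f0 t \<subseteq> M" "f0 t \<inter> M1 \<noteq> {}" "\<not> M1 \<subseteq> f0 t" by (simp_all add: Reg_def M_def)
      then show ?thesis using BM(2) by blast
    qed
    obtain E1 where E1: "E1 \<subseteq> E0" "card (E0 - E1) \<le> card A - 1" "tile (?sp (f0 ` A) \<union> E1)"
      using tile_absorb_rest[OF f0(1) f0M _ fins(3) finK(1) disj(1-3) cT] fins(1,2)
      unfolding E0_def[symmetric] by (auto simp: M_def)
    have U: "M \<union> T0 \<union> K = {1..n}" using BM K by (auto simp: B_def)
    have mid: "middle_cube n = Reg B K \<union> E0"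
    proof -
      have "X \<in> middle_cube n \<longleftrightarrow> X \<subseteq> B \<union> K \<and> X \<noteq> {} \<and> X \<noteq> B \<union> K" for X
        using U BM by (auto simp: middle_cube_def)
      moreover have "B \<noteq> {}" using M1 e by blast
      ultimately show ?thesis
        unfolding E0_def BM(1)[symmetric] by (auto simp: Reg_def)
    qed
    have RE: "Reg B K \<inter> E0 = {}" unfolding E0_def BM(1)[symmetric] Reg_def by blast
    have sub: "Reg M1 (B - M1 \<union> K) \<subseteq> Reg B K" using M1 by (auto simp: Reg_def)
    have sp_Un: "?sp (P \<union> P') = ?sp P \<union> ?sp P'" for P P' by blast
    have "Reg M1 M0 - f0 ` A \<union> f0 ` A = Reg M1 M0" using f0(2) by blast
    then have spU: "Reg M1 (B - M1 \<union> K) = ?sp (Reg M1 M0 - f0 ` A) \<union> ?sp (f0 ` A)"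
      unfolding RL sp_Un[symmetric] by (simp only:)
    have spI: "?sp (Reg M1 M0 - f0 ` A) \<inter> ?sp (f0 ` A) = {}"
    proof (rule equals0I)
      fix X assume "X \<in> ?sp (Reg M1 M0 - f0 ` A) \<inter> ?sp (f0 ` A)"
      then obtain Z Y Z' Y' where X: "X = Z \<union> Y" "Z \<in> Reg M1 M0" "Z \<notin> f0 ` A" "Y \<subseteq> ?L"
        "X = Z' \<union> Y'" "Z' \<in> f0 ` A" "Y' \<subseteq> ?L" by blast
      then have "Z \<subseteq> M" "Z' \<subseteq> M" using RM f0(2) by blast+
      then have "Z = X \<inter> M" "Z' = X \<inter> M" using X(1,4,5,7) disjL by blast+
      then show False using X(3,6) by simp
    qed
    have "Reg B K \<inter> E1 = {}" using RE E1(1) by blast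
    \<comment> \<open>Three parts: sets not splitting \<open>M1\<close>, sets over the other tiles
      of \<open>Reg M1 M0\<close>, and sets over the tile \<open>f0\<close> retiled together with
      \<open>E1\<close>.\<close>
    then have "tile (Reg B K \<union> E1)"
      using 1 sub unfolding spU by (intro tile_assemble[OF _ 2 E1(3) spI])
    moreover have "middle_cube n - (Reg B K \<union> E1) = E0 - E1" using mid RE by blast
    ultimately show ?thesis using E1 mid by (intro exI[of _ "Reg B K \<union> E1"]) auto
  qed
  then show ?thesis by blast
qed

section \<open>From tileable sets to families of copies\<close>

lemma tile_imp_copies:
  assumes "tile X" "X \<subseteq> Q"
  shows "\<exists>\<P>. (\<forall>Q'\<in>\<P>. is_copy A r Q (inclusion_on Q) Q') \<and> pairwise disjnt \<P> \<and> \<Union>\<P> = X"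
proof -
  obtain \<P> where P: "\<forall>K\<in>\<P>. \<exists>f. emb f \<and> K = f ` A" "pairwise disjnt \<P>" "\<Union>\<P> = X"
    using assms(1) unfolding tile_def by blast
  have "is_copy A r Q (inclusion_on Q) K" if K: "K \<in> \<P>" for K
  proof -
    obtain f where f: "emb f" "K = f ` A" using P(1) K by blast
    have "K \<subseteq> Q" using K P(3) assms(2) by blast
    moreover have "bij_betw f A K" using emb_inj_on[OF f(1)] f(2) by (simp add: bij_betw_def)
    ultimately show ?thesis
      using f embD[OF f(1)] unfolding is_copy_def poset_isomorphic_def inclusion_on_def relation_of_def
      by (intro conjI exI[of _ f] ballI) auto
  qed
  then show ?thesis using P(2,3) by blast
qed

end

theorem theorem2:
  fixes A :: "'a set" and r :: "'a rel"
  assumes "finite A" and "A \<noteq> {}" and "partial_order_on A r"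
  shows "\<exists>n0::nat. \<forall>n\<ge>n0. \<exists>\<P> :: nat set set set.
    (\<forall>Q'\<in>\<P>. is_copy A r (middle_cube n) (inclusion_on (middle_cube n)) Q') \<and>
    pairwise disjnt \<P> \<and>
    card (middle_cube n - \<Union>\<P>) \<le> card A - 1"
proof -
  interpret finite_poset A r using assms by unfold_locales
  obtain n0 where n0: "\<forall>n\<ge>n0. \<exists>X\<subseteq>middle_cube n. tile X \<and> card (middle_cube n - X) \<le> card A - 1"
    using ex_tile_middle_cube by blast
  show ?thesis
  proof (intro exI[of _ n0] allI impI)
    fix n assume "n0 \<le> n"
    then obtain X where X: "X \<subseteq> middle_cube n" "tile X" "card (middle_cube n - X) \<le> card A - 1"
      using n0 by blast
    then show "\<exists>\<P> :: nat set set set.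
      (\<forall>Q'\<in>\<P>. is_copy A r (middle_cube n) (inclusion_on (middle_cube n)) Q') \<and>
      pairwise disjnt \<P> \<and> card (middle_cube n - \<Union>\<P>) \<le> card A - 1"
      using tile_imp_copies[OF X(2,1)] by metis
  qed
qed

end
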